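(* Let $n\geq2$ and let $M$ be a monoid. Define the alphabet $X_2=\{e_{ij;a,b}: i,j\in\{1,\ldots,n\},\ i\neq j,\ a,b\in M\}$, write $e_{ij}=e_{ij;1,1}$, and let $\phi_2:X_2^+\to M\wr\mathrm{Sing}_n$ be the homomorphism with $e_{ij;a,b}\phi_2=\varepsilon_{ij;a,b}$. Let $R_2$ be the following set of relations over $X_2$, where $a,b,c,d$ range over all elements of $M$ and $i,j,k,l$ over all distinct elements of $\{1,\ldots,n\}$ (as many as occur in the given relation): - $e_{ij;a,b}e_{ij;c,d}=e_{ij;ac,bc}=e_{ji;b,a}e_{ij;d,c}$; - $e_{ij;a,b}e_{kl;c,d}=e_{kl;c,d}e_{ij;a,b}$; - $e_{ik;a,b}e_{jk;1,c}=e_{ik;a,b}$; - $e_{ik;a,b}e_{jk;c,1}=e_{ki;b,a}e_{ji;c,1}e_{ik;1,1}$; - $e_{ik;a,a}e_{jk;b,1}=e_{ik;1,1}e_{jk;b,1}e_{ik;a,1}$; - $e_{ij;a,b}e_{ik;c,d}=e_{ik;ac,d}e_{ij;1,bc}=e_{jk;bc,d}e_{ij;ac,1}$; - $e_{ij;c,ad}e_{ik;1,bd}=e_{ik;c,bd}e_{ij;1,ad}=e_{jk;a,b}e_{ij;c,d}$; - $e_{ki}e_{ij}e_{jk}=e_{ik}e_{kj}e_{ji}e_{ik}$; - $e_{ki}e_{ij}e_{jk}e_{kl}=e_{ik}e_{kl}e_{li}e_{ij}e_{jl}$. Then the semigroup $M\wr\mathrm{Sing}_n$ has semigroup presentation $\langle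 X_2:R_2\rangle$ via $\phi_2$.
   Context: Maps are written on the right and composed from left to right. $\mathcal T_n$ is the monoid of all maps $\{1,\ldots,n\}\to\{1,\ldots,n\}$, and $\mathrm{Sing}_n$ is its subsemigroup of all non-bijective maps. The wreath product $M\wr\mathrm{Sing}_n$ is the set $M^n\times\mathrm{Sing}_n$ with product $$((a_1,\ldots,a_n),\alpha)((b_1,\ldots,b_n),\beta)=((a_1b_{1\alpha},\ldots,a_nb_{n\alpha}),\alpha\beta).$$ For distinct $i,j\in\{1,\ldots,n\}$, $\varepsilon_{ij}\in\mathrm{Sing}_n$ is the map with $j\varepsilon_{ij}=i$ and $k\varepsilon_{ij}=k$ for $k\neq j$. For $a,b\in M$, $\varepsilon_{ij;a,b}=(\mathbf a,\varepsilon_{ij})\in M\wr\mathrm{Sing}_n$, where $\mathbf a=(a_1,\ldots,a_n)$ has $a_i=a$, $a_j=b$ and $a_k=1$ for $k\notin\{i,j\}$. In a letter such as $e_{ij;ac,bc}$ the two monoid subscripts, separated by a comma, are the products $ac$ and $bc$ in $M$. For an alphabet $X$, $X^+$ is the free semigroup on $X$. A relation $u=v$ stands for the pair $(u,v)\in X^+\times X^+$ (a chain $u=v=w$ stands for $u=v$ and $v=w$), and $R^\sharp$ is the congruence on $X^+$ generated by a set $R$ of relations. A semigroup $T$ has semigroup presentation $\langle X:R\rangle$ via $\phi:X^+\to T$ if $\phi$ is a surjective homomorphism with kernel $\{(u,v):u\phi=v\phi\}=R^\sharp$. *)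

theory Defs
  imports Main "HOL-Library.Cardinality"
begin

text \<open>Words over the alphabet \<open>X\<close> are lists with entries in \<open>X\<close>; the product of the free
  semigroup is concatenation.\<close>

definition free_semigroup :: "'x set \<Rightarrow> 'x list set" where
  "free_semigroup X = {w. set w \<subseteq> X \<and> w \<noteq> []}"

definition congruence_on :: "'x set \<Rightarrow> ('x list \<times> 'x list) set \<Rightarrow> bool" where
  "congruence_on X r \<longleftrightarrow>
     equiv (free_semigroup X) r \<and>
     (\<forall>(u, v) \<in> r. \<forall>w \<in> free_semigroup X. (w @ u, w @ v) \<in> r \<and> (u @ w, v @ w) \<in> r)"

definition generated_congruence ::
    "'x set \<Rightarrow> ('x list \<times> 'x list) set \<Rightarrow> ('x list \<times> 'x list) set" where
  "generated_congruence X R = \<Inter> {r. congruence_on X r \<and> R \<subseteq> r}"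

text \<open>A semigroup is given by a carrier \<open>T\<close> and an operation \<open>f\<close>.\<close>

definition semigroup_on :: "'t set \<Rightarrow> ('t \<Rightarrow> 't \<Rightarrow> 't) \<Rightarrow> bool" where
  "semigroup_on T f \<longleftrightarrow>
     (\<forall>x \<in> T. \<forall>y \<in> T. f x y \<in> T) \<and>
     (\<forall>x \<in> T. \<forall>y \<in> T. \<forall>z \<in> T. f (f x y) z = f x (f y z))"

definition semigroup_presentation ::
    "'t set \<Rightarrow> ('t \<Rightarrow> 't \<Rightarrow> 't) \<Rightarrow> 'x set \<Rightarrow> ('x list \<times> 'x list) set \<Rightarrow> ('x list \<Rightarrow> 't) \<Rightarrow> bool" where
  "semigroup_presentation T f X R \<phi> \<longleftrightarrow>
     semigroup_on T f \<and>
     R \<subseteq> free_semigroup X \<times> free_semigroup X \<and>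
     (\<forall>u \<in> free_semigroup X. \<forall>v \<in> free_semigroup X. \<phi> (u @ v) = f (\<phi> u) (\<phi> v)) \<and>
     \<phi> ` free_semigroup X = T \<and>
     {(u, v) \<in> free_semigroup X \<times> free_semigroup X. \<phi> u = \<phi> v} = generated_congruence X R"

text \<open>The homomorphism from the free semigroup that extends the map \<open>g\<close> on letters.
  The empty word is not in the free semigroup; its value is irrelevant.\<close>

fun hom_ext :: "('t \<Rightarrow> 't \<Rightarrow> 't) \<Rightarrow> ('x \<Rightarrow> 't) \<Rightarrow> 'x list \<Rightarrow> 't" where
  "hom_ext f g [] = undefined"
| "hom_ext f g [x] = g x"
| "hom_ext f g (x # y # w) = f (g x) (hom_ext f g (y # w))"

text \<open>The finite type \<open>'n\<close> plays the role of the index set \<open>{1, \<dots>, n}\<close>, with \<open>n = CARD('n)\<close>.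
  Maps are composed from left to right: \<open>i\<alpha>\<close> is \<open>\<alpha> i\<close>, and \<open>\<alpha>\<beta>\<close> is \<open>\<beta> \<circ> \<alpha>\<close>.\<close>

definition Sing :: "('n::finite \<Rightarrow> 'n) set" where
  "Sing = {\<alpha>. \<not> bij \<alpha>}"

definition wreath_Sing :: "(('n::finite \<Rightarrow> 'a::monoid_mult) \<times> ('n \<Rightarrow> 'n)) set" where
  "wreath_Sing = UNIV \<times> Sing"

fun wreath_mult ::
    "('n \<Rightarrow> 'a::monoid_mult) \<times> ('n \<Rightarrow> 'n) \<Rightarrow> ('n \<Rightarrow> 'a) \<times> ('n \<Rightarrow> 'n) \<Rightarrow> ('n \<Rightarrow> 'a) \<times> ('n \<Rightarrow> 'n)" where
  "wreath_mult (a, \<alpha>) (b, \<beta>) = (\<lambda>i. a i * b (\<alpha> i), \<beta> \<circ> \<alpha>)"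

definition eps :: "'n \<Rightarrow> 'n \<Rightarrow> 'n \<Rightarrow> 'n" where
  "eps i j = (\<lambda>k. if k = j then i else k)"

definition eps_wr :: "'n \<Rightarrow> 'n \<Rightarrow> 'a \<Rightarrow> 'a::monoid_mult \<Rightarrow> ('n \<Rightarrow> 'a) \<times> ('n \<Rightarrow> 'n)" where
  "eps_wr i j a b = (\<lambda>k. if k = i then a else if k = j then b else 1, eps i j)"

text \<open>\<open>E i j a b\<close> is the letter \<open>e\<^bsub>ij;a,b\<^esub>\<close>; only the letters with \<open>i \<noteq> j\<close> belong to \<open>X2\<close>.\<close>

datatype ('n, 'a) letter = E 'n 'n 'a 'a

abbreviation E1 :: "'n \<Rightarrow> 'n \<Rightarrow> ('n, 'a::monoid_mult) letter" where
  "E1 i j \<equiv> E i j 1 1"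

definition X2 :: "('n, 'a) letter set" where
  "X2 = {E i j a b | i j a b. i \<noteq> j}"

fun letter_val :: "('n, 'a::monoid_mult) letter \<Rightarrow> ('n \<Rightarrow> 'a) \<times> ('n \<Rightarrow> 'n)" where
  "letter_val (E i j a b) = eps_wr i j a b"

definition phi2 :: "('n, 'a::monoid_mult) letter list \<Rightarrow> ('n \<Rightarrow> 'a) \<times> ('n \<Rightarrow> 'n)" where
  "phi2 = hom_ext wreath_mult letter_val"

inductive_set R2 :: "(('n, 'a::monoid_mult) letter list \<times> ('n, 'a) letter list) set" where
  mult: "distinct [i, j] \<Longrightarrow>
    ([E i j a b, E i j c d], [E i j (a * c) (b * c)]) \<in> R2"
| mult_swap: "distinct [i, j] \<Longrightarrow>
    ([E i j (a * c) (b * c)], [E j i b a, E i j d c]) \<in> R2"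
| commute: "distinct [i, j, k, l] \<Longrightarrow>
    ([E i j a b, E k l c d], [E k l c d, E i j a b]) \<in> R2"
| absorb: "distinct [i, j, k] \<Longrightarrow>
    ([E i k a b, E j k 1 c], [E i k a b]) \<in> R2"
| rotate: "distinct [i, j, k] \<Longrightarrow>
    ([E i k a b, E j k c 1], [E k i b a, E j i c 1, E1 i k]) \<in> R2"
| shift: "distinct [i, j, k] \<Longrightarrow>
    ([E i k a a, E j k b 1], [E1 i k, E j k b 1, E i k a 1]) \<in> R2"
| fan1: "distinct [i, j, k] \<Longrightarrow>
    ([E i j a b, E i k c d], [E i k (a * c) d, E i j 1 (b * c)]) \<in> R2"
| fan2: "distinct [i, j, k] \<Longrightarrow>
    ([E i k (a * c) d, E i j 1 (b * c)], [E j k (b * c) d, E i j (a * c) 1]) \<in> R2"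
| tree1: "distinct [i, j, k] \<Longrightarrow>
    ([E i j c (a * d), E i k 1 (b * d)], [E i k c (b * d), E i j 1 (a * d)]) \<in> R2"
| tree2: "distinct [i, j, k] \<Longrightarrow>
    ([E i k c (b * d), E i j 1 (a * d)], [E j k a b, E i j c d]) \<in> R2"
| path3: "distinct [i, j, k] \<Longrightarrow>
    ([E1 k i, E1 i j, E1 j k], [E1 i k, E1 k j, E1 j i, E1 i k]) \<in> R2"
| path4: "distinct [i, j, k, l] \<Longrightarrow>
    ([E1 k i, E1 i j, E1 j k, E1 k l], [E1 i k, E1 k l, E1 l i, E1 i j, E1 j l]) \<in> R2"

end

theory Submission
  imports Defs "HOL-Combinatorics.Permutations"
begin

text \<open>
  A word is read as a sequence of moves of \<open>n\<close> labelled tokens on \<open>n\<close> positions: the letter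
  \<open>e\<^bsub>ij;a,b\<^esub>\<close> multiplies the labels at \<open>i\<close> and \<open>j\<close> by \<open>a\<close> and \<open>b\<close> and then moves everything at \<open>j\<close>
  onto \<open>i\<close>, so that \<open>j\<close> becomes a hole.  In the monoid presented by \<open>R2\<close>, a hole may be inserted or
  used freely, a move into a hole can be undone, and the two path relations say exactly that
  the hole moves from a fixed hole back to itself satisfy the relations \<open>(p q)(q r) = (q r)(p r)\<close>
  and \<open>(p q)\<^sup>2 = 1\<close> between transpositions.  As these relations present the symmetric group, words
  with a hole admit a right action of all permutations.

  An unlabelled word can therefore be rewritten as a product of commuting merges \<open>e\<^bsub>ij\<^esub>\<close> onto class
  representatives followed by a permutation; words with the same kernel absorb each other's
  merges from the left, which gives uniqueness.  Labels can be pushed to the front of a word,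
  where they are collected in one letter \<open>e\<^bsub>ij;a,b\<^esub>\<close> and labels \<open>e\<^bsub>kj;c,1\<^esub>\<close>; the pair \<open>(i, j)\<close> may be
  any pair of distinct points identified by the map.
\<close>

section \<open>The monoid presented by \<open>R2\<close>\<close>

text \<open>The congruence lives on the free monoid, so that the quotient has an identity and
  prefixes may be trivial. Both sides of every relation are non-empty words over \<open>X2\<close>,
  so nothing is lost for the free semigroup; \<open>congruence_eqv\<close> makes this
  precise.\<close>

inductive eqv :: "('n, 'a::monoid_mult) letter list \<Rightarrow> ('n, 'a) letter list \<Rightarrow> bool" where
  refl: "eqv u u"
| sym: "eqv u v \<Longrightarrow> eqv v u"
| trans: "eqv u v \<Longrightarrow> eqv v w \<Longrightarrow> eqv u w"
| step: "(l, r) \<in> R2 \<Longrightarrow> eqv (p @ l @ s) (p @ r @ s)"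

lemma equivp_eqv: "equivp eqv"
  by (rule equivpI) (auto simp: reflp_def symp_def transp_def intro: eqv.intros)

lemma eqv_append:
  assumes "eqv u v" shows "eqv (p @ u @ s) (p @ v @ s)"
  using assms
proof (induction rule: eqv.induct)
  case (step l r p' s')
  then show ?case using eqv.step[of l r "p @ p'" "s' @ s"] by simp
qed (auto intro: eqv.intros)

quotient_type (overloaded) ('n, 'a) wmon = "('n, 'a::monoid_mult) letter list" / eqv
  by (rule equivp_eqv)

instantiation wmon :: (type, monoid_mult) monoid_mult
begin

lift_definition one_wmon :: "('a, 'b) wmon" is "[]" .

lift_definition times_wmon :: "('a, 'b) wmon \<Rightarrow> ('a, 'b) wmon \<Rightarrow> ('a, 'b) wmon" is "(@)"
  by (metis append.assoc append.left_neutral append.right_neutral eqv.trans eqv_append)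

instance
  by standard (transfer; simp add: eqv.refl)+

end

lift_definition gen :: "'n \<Rightarrow> 'n \<Rightarrow> 'a \<Rightarrow> 'a \<Rightarrow> ('n, 'a::monoid_mult) wmon"
  is "\<lambda>i j a b. [E i j a b]" .

abbreviation gen1 :: "'n \<Rightarrow> 'n \<Rightarrow> ('n, 'a::monoid_mult) wmon" where
  "gen1 i j \<equiv> gen i j 1 1"

lemma eqv_R2: "(l, r) \<in> R2 \<Longrightarrow> eqv l r"
  using eqv.step[of l r "[]" "[]"] by simp

lemma gen_mult:
  "i \<noteq> j \<Longrightarrow> gen i j a b * gen i j c d = gen i j (a * c) (b * c)"
  by transfer (auto intro!: eqv_R2 R2.mult)

lemma gen_mult_swap:
  "i \<noteq> j \<Longrightarrow> gen j i b a * gen i j d c = gen i j (a * c) (b * c)"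
  by transfer (auto intro!: eqv.sym[OF eqv_R2[OF R2.mult_swap]])

lemma gen_commute:
  "distinct [i, j, k, l] \<Longrightarrow> gen i j a b * gen k l c d = gen k l c d * gen i j a b"
  by transfer (auto intro!: eqv_R2 R2.commute)

lemma gen_absorb:
  "distinct [i, j, k] \<Longrightarrow> gen i k a b * gen j k 1 c = gen i k a b"
  by transfer (auto intro!: eqv_R2 R2.absorb)

lemma gen_rotate:
  "distinct [i, j, k] \<Longrightarrow> gen i k a b * gen j k c 1 = gen k i b a * gen j i c 1 * gen1 i k"
  by transfer (auto intro!: eqv_R2 R2.rotate)

lemma gen_shift:
  "distinct [i, j, k] \<Longrightarrow> gen i k a a * gen j k b 1 = gen1 i k * gen j k b 1 * gen i k a 1"
  by transfer (auto intro!: eqv_R2 R2.shift)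

lemma gen_fan1:
  "distinct [i, j, k] \<Longrightarrow> gen i j a b * gen i k c d = gen i k (a * c) d * gen i j 1 (b * c)"
  by transfer (auto intro!: eqv_R2 R2.fan1)

lemma gen_fan2:
  "distinct [i, j, k] \<Longrightarrow>
    gen i k (a * c) d * gen i j 1 (b * c) = gen j k (b * c) d * gen i j (a * c) 1"
  by transfer (auto intro!: eqv_R2 R2.fan2)

lemma gen_tree1:
  "distinct [i, j, k] \<Longrightarrow>
    gen i j c (a * d) * gen i k 1 (b * d) = gen i k c (b * d) * gen i j 1 (a * d)"
  by transfer (auto intro!: eqv_R2 R2.tree1)

lemma gen_tree2:
  "distinct [i, j, k] \<Longrightarrow>
    gen i k c (b * d) * gen i j 1 (a * d) = gen j k a b * gen i j c d"
  by transfer (auto intro!: eqv_R2 R2.tree2)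

lemma gen_path3:
  "distinct [i, j, k] \<Longrightarrow>
    u * (gen1 k i * gen1 i j * gen1 j k) = u * (gen1 i k * gen1 k j * gen1 j i * gen1 i k)"
  by (rule arg_cong[of _ _ "(*) u"], transfer) (auto intro!: eqv_R2 R2.path3)

lemma gen_path4:
  "distinct [i, j, k, l] \<Longrightarrow>
    u * (gen1 k i * gen1 i j * gen1 j k * gen1 k l)
      = u * (gen1 i k * gen1 k l * gen1 l i * gen1 i j * gen1 j l)"
  by (rule arg_cong[of _ _ "(*) u"], transfer) (auto intro!: eqv_R2 R2.path4)

section \<open>Elements with a hole\<close>

text \<open>\<open>hole h u\<close> expresses inside the presented monoid that \<open>h\<close> is not in the image of \<open>u\<close>.\<close>

definition hole :: "'n \<Rightarrow> ('n, 'a::monoid_mult) wmon \<Rightarrow> bool" where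
  "hole h u \<longleftrightarrow> (\<forall>k c. k \<noteq> h \<longrightarrow> u * gen k h 1 c = u)"

lemma holeD: "hole h u \<Longrightarrow> k \<noteq> h \<Longrightarrow> u * gen k h 1 c = u"
  by (simp add: hole_def)

lemma hole_gen:
  assumes "i \<noteq> j"
  shows "hole j (u * gen i j a b)"
  unfolding hole_def
proof (intro allI impI)
  fix k c assume "k \<noteq> j"
  show "u * gen i j a b * gen k j 1 c = u * gen i j a b"
  proof (cases "k = i")
    case True
    then show ?thesis using assms by (simp add: mult.assoc gen_mult)
  next
    case False
    then show ?thesis using assms \<open>k \<noteq> j\<close> by (simp add: mult.assoc gen_absorb)
  qed
qed

text \<open>A pattern used throughout: the hole lets \<open>gen1 k h\<close> be inserted freely, a
  fan relation slides it past the next letter, and at the end of the product it exhibits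
  \<open>h\<close> as a hole again.\<close>

lemma hole_persists:
  assumes "hole h u" "k \<noteq> h" "k \<noteq> l"
  shows "hole h (u * gen k l c d)"
proof (cases "l = h")
  case True
  then show ?thesis using hole_gen[of k h] assms by simp
next
  case False
  have "u * gen k l c d = u * gen k h 1 1 * gen k l c d"
    using assms holeD by metis
  also have "\<dots> = u * gen k l c d * gen k h 1 c"
    using gen_fan1[of k h l 1 1 c d] assms False by (simp add: mult.assoc)
  finally show ?thesis
    using hole_gen[of k h "u * gen k l c d"] assms by metis
qed

text \<open>A label on an empty position is invisible: after inserting \<open>gen1 k h\<close>, the
  right-hand side of \<open>gen_mult\<close> no longer mentions \<open>d\<close>.\<close>

lemma hole_second_label:
  assumes "hole h u" "k \<noteq> h"
  shows "u * gen k h c d = u * gen k h c c'"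
proof -
  have "u * gen k h c d = u * gen k h c c" for d
  proof -
    have "u * gen k h c d = u * gen1 k h * gen k h c d"
      using assms holeD by metis
    also have "\<dots> = u * gen k h c c"
      using assms by (simp add: mult.assoc gen_mult)
    finally show ?thesis .
  qed
  then show ?thesis by metis
qed

lemma hole_move_cancel:
  assumes "hole h u" "h \<noteq> p"
  shows "u * gen1 h p * gen1 p h = u"
proof -
  have "u * gen1 h p * gen1 p h = u * gen1 p h"
    using assms by (simp add: mult.assoc gen_mult_swap)
  then show ?thesis using assms holeD by metis
qed

text \<open>Each side interchanges the tokens at \<open>p\<close> and \<open>q\<close> through the
  empty position \<open>h\<close>; they differ in which token is set aside first. This makes
  \<open>hole_swap\<close> symmetric in \<open>p\<close> and \<open>q\<close>.\<close>

lemma hole_loop3: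
  assumes "hole h u" "distinct [h, p, q]"
  shows "u * gen1 h p * gen1 p q * gen1 q h = u * gen1 h q * gen1 q p * gen1 p h"
proof -
  \<comment> \<open>inserting the trivial loop \<open>h q h\<close> makes the path relation applicable after any prefix\<close>
  have "u * gen1 h p * gen1 p q = u * gen1 h q * (gen1 q h * gen1 h p * gen1 p q)"
    using hole_move_cancel[OF assms(1), of q] assms(2) by (auto simp: mult.assoc[symmetric])
  also have "\<dots> = u * (gen1 h q * gen1 h q) * gen1 q p * gen1 p h * gen1 h q"
    using assms gen_path3[of h p q "u * gen1 h q"] by (simp add: mult.assoc)
  also have "\<dots> = u * gen1 h q * gen1 q p * gen1 p h * gen1 h q"
    using assms by (simp add: gen_mult)
  finally have "u * gen1 h p * gen1 p q * gen1 q h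
      = u * gen1 h q * gen1 q p * gen1 p h * gen1 h q * gen1 q h" by simp
  also have "\<dots> = u * gen1 h q * gen1 q p * gen1 p h"
    by (rule hole_move_cancel) (use assms hole_gen[of p h] in auto)
  finally show ?thesis .
qed

text \<open>Followed by one more move \<open>gen1 r h\<close>, this is (p q)(q r) = (q r)(p r)
  carried out through \<open>h\<close>, with a cancelled excursion to \<open>h\<close> already
  removed on the left.\<close>

lemma hole_loop4:
  assumes "hole h u" "distinct [h, p, q, r]"
  shows "u * gen1 h p * gen1 p q * gen1 q r
    = u * gen1 h q * gen1 q r * gen1 r h * gen1 h p * gen1 p r"
proof -
  have "u * gen1 h p * gen1 p q * gen1 q r
      = u * gen1 h q * (gen1 q h * gen1 h p * gen1 p q * gen1 q r)"
    using hole_move_cancel[OF assms(1), of q] assms(2) by (auto simp: mult.assoc[symmetric])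
  also have "\<dots> = u * (gen1 h q * gen1 h q) * gen1 q r * gen1 r h * gen1 h p * gen1 p r"
    using assms gen_path4[of h p q r "u * gen1 h q"] by (simp add: mult.assoc)
  also have "\<dots> = u * gen1 h q * gen1 q r * gen1 r h * gen1 h p * gen1 p r"
    using assms by (simp add: gen_mult)
  finally show ?thesis .
qed

section \<open>A presentation of the symmetric group by transpositions\<close>

fun perm :: "('n \<times> 'n) list \<Rightarrow> 'n \<Rightarrow> 'n" where
  "perm [] = id"
| "perm ((p, q) # ps) = perm ps \<circ> transpose p q"

lemma perm_append [simp]: "perm (ps @ qs) = perm qs \<circ> perm ps"
  by (induction ps rule: perm.induct) (auto simp: o_assoc)

text \<open>Trivial pairs \<open>(p, p)\<close> count as letters, so that every coset representative
  in \<open>swap_eq_pull\<close> is a single letter \<open>(x, y)\<close>. Commutation of disjoint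
  transpositions is not imposed but derived.\<close>

inductive swap_eq :: "('n \<times> 'n) list \<Rightarrow> ('n \<times> 'n) list \<Rightarrow> bool" where
  refl: "swap_eq ps ps"
| sym: "swap_eq ps qs \<Longrightarrow> swap_eq qs ps"
| trans: "swap_eq ps qs \<Longrightarrow> swap_eq qs rs \<Longrightarrow> swap_eq ps rs"
| append: "swap_eq ps qs \<Longrightarrow> swap_eq ps' qs' \<Longrightarrow> swap_eq (ps @ ps') (qs @ qs')"
| triv: "swap_eq [(p, p)] []"
| inv: "swap_eq [(p, q), (p, q)] []"
| flip: "swap_eq [(p, q)] [(q, p)]"
| conj: "distinct [p, q, r] \<Longrightarrow> swap_eq [(p, q), (q, r)] [(q, r), (p, r)]"

lemmas [trans] = swap_eq.trans

lemma swap_eq_ctx: "swap_eq ps qs \<Longrightarrow> swap_eq (xs @ ps @ ys) (xs @ qs @ ys)"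
  by (intro swap_eq.append swap_eq.refl)

text \<open>A cancelling pair (b c)(b c) is inserted to link the two transpositions; repeated
  conjugation turns it into a pair (b d)(b d), which cancels again.\<close>

lemma swap_eq_commute:
  assumes "distinct [a, b, c, d]"
  shows "swap_eq [(a, b), (c, d)] [(c, d), (a, b)]"
proof -
  have "swap_eq [(a,b),(c,d)] [(a,b),(b,c),(b,c),(c,d)]"
    using swap_eq_ctx[OF swap_eq.sym[OF swap_eq.inv[of b c]], of "[(a,b)]" "[(c,d)]"] by simp
  also have "swap_eq \<dots> [(b,c),(a,c),(b,c),(c,d)]"
    using swap_eq_ctx[OF swap_eq.conj[of a b c], of "[]" "[(b,c),(c,d)]"] assms by simp
  also have "swap_eq \<dots> [(b,c),(a,c),(c,d),(b,d)]"
    using swap_eq_ctx[OF swap_eq.conj[of b c d], of "[(b,c),(a,c)]" "[]"] assms by simp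
  also have "swap_eq \<dots> [(b,c),(c,d),(a,d),(b,d)]"
    using swap_eq_ctx[OF swap_eq.conj[of a c d], of "[(b,c)]" "[(b,d)]"] assms by simp
  also have "swap_eq \<dots> [(b,c),(c,d),(a,d),(d,b)]"
    using swap_eq_ctx[OF swap_eq.flip[of b d], of "[(b,c),(c,d),(a,d)]" "[]"] by simp
  also have "swap_eq \<dots> [(b,c),(c,d),(d,b),(a,b)]"
    using swap_eq_ctx[OF swap_eq.conj[of a d b], of "[(b,c),(c,d)]" "[]"] assms by auto
  also have "swap_eq \<dots> [(b,c),(c,d),(b,d),(a,b)]"
    using swap_eq_ctx[OF swap_eq.flip[of d b], of "[(b,c),(c,d)]" "[(a,b)]"] by simp
  also have "swap_eq \<dots> [(c,d),(b,d),(b,d),(a,b)]"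
    using swap_eq_ctx[OF swap_eq.conj[of b c d], of "[]" "[(b,d),(a,b)]"] assms by simp
  also have "swap_eq \<dots> [(c,d),(a,b)]"
    using swap_eq_ctx[OF swap_eq.inv[of b d], of "[(c,d)]" "[(a,b)]"] by simp
  finally show ?thesis .
qed

lemma swap_eq_perm: "swap_eq ps qs \<Longrightarrow> perm ps = perm qs"
  by (induction rule: swap_eq.induct)
     (auto simp: fun_eq_iff transpose_def)

definition entries :: "('n \<times> 'n) list \<Rightarrow> 'n set" where
  "entries ps = fst ` set ps \<union> snd ` set ps"

lemma entries_simps [simp]:
  "entries [] = {}"
  "entries ((p, q) # ps) = {p, q} \<union> entries ps"
  "entries (ps @ qs) = entries ps \<union> entries qs"
  by (auto simp: entries_def)

lemma perm_fixes: "x \<notin> entries ps \<Longrightarrow> perm ps x = x"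
  by (induction ps rule: perm.induct) auto

text \<open>One step of a coset enumeration: \<open>rs\<close> fixes \<open>x\<close>, and
  \<open>(x, z)\<close> is the new representative. The cases are the possible overlaps of the two
  pairs; flipping \<open>(p, q)\<close> reduces overlaps at \<open>q\<close> to overlaps at
  \<open>p\<close>.\<close>

lemma swap_eq_pull_step:
  assumes "p \<noteq> q" "y \<noteq> x"
  shows "\<exists>rs z. entries rs \<subseteq> {y, p, q} - {x} \<and> z \<in> {x, y, p, q} \<and>
    swap_eq [(x, y), (p, q)] (rs @ [(x, z)])"
proof -
  have *: "\<exists>rs z. entries rs \<subseteq> {y, q} - {x} \<and> z \<in> {x, y, q} \<and>
      swap_eq [(x, y), (x, q)] (rs @ [(x, z)])" if "q \<noteq> x" for q
  proof (cases "q = y")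
    case True
    have "swap_eq [(x, y), (x, q)] ([] @ [(x, x)])"
      using True swap_eq.trans[OF swap_eq.inv swap_eq.sym[OF swap_eq.triv]] by auto
    then show ?thesis by (metis empty_subsetI entries_simps(1) insertI1)
  next
    case False
    have "swap_eq [(x, y), (x, q)] [(y, x), (x, q)]"
      using swap_eq_ctx[OF swap_eq.flip[of x y], of "[]" "[(x,q)]"] by simp
    also have "swap_eq \<dots> [(y, x), (q, x)]"
      using swap_eq_ctx[OF swap_eq.flip[of x q], of "[(y,x)]" "[]"] by simp
    also have "swap_eq \<dots> [(q, y), (y, x)]"
      using swap_eq.sym[OF swap_eq.conj[of q y x]] False that assms by simp
    also have "swap_eq \<dots> ([(q, y)] @ [(x, y)])"
      using swap_eq_ctx[OF swap_eq.flip[of y x], of "[(q,y)]" "[]"] by simp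
    finally show ?thesis using False that assms
      by (intro exI[of _ "[(q, y)]"] exI[of _ y]) auto
  qed
  have **: "\<exists>rs z. entries rs \<subseteq> {y, q} - {x} \<and> z \<in> {x, y, q} \<and>
      swap_eq [(x, y), (y, q)] (rs @ [(x, z)])" if "q \<noteq> x" "q \<noteq> y" for q
    using that assms swap_eq.conj[of x y q]
    by (intro exI[of _ "[(y, q)]"] exI[of _ q]) auto
  have fl: "swap_eq [(x, y), (p, q)] [(x, y), (q, p)]"
    using swap_eq_ctx[OF swap_eq.flip[of p q], of "[(x,y)]" "[]"] by simp
  consider "p = x" | "q = x" | "p = y" "q \<noteq> x" | "q = y" "p \<noteq> x" | "distinct [x, y, p, q]"
    using assms by auto
  then show ?thesis
  proof cases
    case 1
    then show ?thesis using *[of q] assms by auto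
  next
    case 2
    then obtain rs z where "entries rs \<subseteq> {y, p} - {x}" "z \<in> {x, y, p}"
      "swap_eq [(x, y), (x, p)] (rs @ [(x, z)])" using *[of p] assms by auto
    then show ?thesis using 2 swap_eq.trans[OF fl, of "rs @ [(x, z)]"]
      by (intro exI[of _ rs] exI[of _ z]) auto
  next
    case 3
    then show ?thesis using **[of q] assms by auto
  next
    case 4
    then obtain rs z where "entries rs \<subseteq> {y, p} - {x}" "z \<in> {x, y, p}"
      "swap_eq [(x, y), (y, p)] (rs @ [(x, z)])" using **[of p] assms by auto
    then show ?thesis using 4 swap_eq.trans[OF fl, of "rs @ [(x, z)]"]
      by (intro exI[of _ rs] exI[of _ z]) auto
  next
    case 5
    then show ?thesis using swap_eq_commute[of x y p q]
      by (intro exI[of _ "[(p, q)]"] exI[of _ y]) auto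
  qed
qed

text \<open>The letters \<open>(x, y)\<close> represent the cosets of the stabiliser of
  \<open>x\<close>, and \<open>rs\<close> is a word for an element of that stabiliser; the letters
  of \<open>ps\<close> are absorbed from left to right.\<close>

lemma swap_eq_pull:
  assumes "entries ps \<subseteq> insert x A"
  shows "\<exists>rs y. entries rs \<subseteq> insert x A - {x} \<and> y \<in> insert x A \<and> swap_eq ps (rs @ [(x, y)])"
  using assms
proof (induction ps rule: rev_induct)
  case Nil
  then show ?case
    by (intro exI[of _ "[]"] exI[of _ x]) (auto intro: swap_eq.sym swap_eq.triv)
next
  case (snoc a ps)
  obtain p q where a: "a = (p, q)" by fastforce
  from snoc a obtain rs y where IH: "entries rs \<subseteq> insert x A - {x}" "y \<in> insert x A"
    "swap_eq ps (rs @ [(x, y)])" by auto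
  have pq: "p \<in> insert x A" "q \<in> insert x A" using snoc.prems a by auto
  have ps: "swap_eq (ps @ [a]) (rs @ [(x, y), (p, q)])"
    using swap_eq.append[OF IH(3) swap_eq.refl[of "[a]"]] a by simp
  consider "p = q" | "p \<noteq> q" "y = x" | "p \<noteq> q" "y \<noteq> x" by blast
  then show ?case
  proof cases
    case 1
    have "swap_eq (rs @ [(x, y), (p, q)]) (rs @ [(x, y)])"
      using swap_eq_ctx[OF swap_eq.triv[of p], of "rs @ [(x, y)]" "[]"] 1 by simp
    then have "swap_eq (ps @ [a]) (rs @ [(x, y)])" by (rule swap_eq.trans[OF ps])
    then show ?thesis using IH by blast
  next
    case 2
    have e: "swap_eq (rs @ [(x, y), (p, q)]) (rs @ [(p, q)])"
      using swap_eq_ctx[OF swap_eq.triv[of x], of rs "[(p, q)]"] 2 by simp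
    have f: "swap_eq (rs @ [(p, q)]) (rs @ [(q, p)])"
      using swap_eq_ctx[OF swap_eq.flip[of p q], of rs "[]"] by simp
    have g: "swap_eq (rs @ [(p, q)]) ((rs @ [(p, q)]) @ [(x, x)])"
      using swap_eq_ctx[OF swap_eq.sym[OF swap_eq.triv[of x]], of "rs @ [(p, q)]" "[]"] by simp
    \<comment> \<open>The old representative is trivial and drops out: a letter involving
      \<open>x\<close> becomes the new representative, any other letter joins \<open>rs\<close> and
      \<open>(x, x)\<close> is appended again.\<close>
    consider "p = x" | "q = x" | "p \<noteq> x" "q \<noteq> x" by blast
    then show ?thesis
    proof cases
      case 1
      then show ?thesis using IH swap_eq.trans[OF ps e] pq by blast
    next
      case 2
      then show ?thesis using IH swap_eq.trans[OF swap_eq.trans[OF ps e] f] pq by blast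
    next
      case 3
      have "entries (rs @ [(p, q)]) \<subseteq> insert x A - {x}" using IH pq 3 by auto
      then show ?thesis using swap_eq.trans[OF swap_eq.trans[OF ps e] g] by blast
    qed
  next
    case 3
    then obtain ss z where s: "entries ss \<subseteq> {y, p, q} - {x}" "z \<in> {x, y, p, q}"
      "swap_eq [(x, y), (p, q)] (ss @ [(x, z)])" using swap_eq_pull_step[of p q y x] by auto
    have "swap_eq (ps @ [a]) ((rs @ ss) @ [(x, z)])"
      using swap_eq.trans[OF ps swap_eq.append[OF swap_eq.refl[of rs] s(3)]] by simp
    moreover have "entries (rs @ ss) \<subseteq> insert x A - {x}" using IH s pq by auto
    moreover have "z \<in> insert x A" using IH s pq by auto
    ultimately show ?thesis by blast
  qed
qed

text \<open>Induction on the set of points: as \<open>perm rs\<close> fixes \<open>x\<close>, a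
  trivial product forces \<open>y = x\<close> in the coset representative \<open>(x, y)\<close>, and
  \<open>rs\<close> is a word over the smaller set.\<close>

lemma perm_id_imp_swap_eq:
  assumes "finite A" "entries ps \<subseteq> A" "perm ps = id"
  shows "swap_eq ps []"
  using assms
proof (induction A arbitrary: ps rule: finite_induct)
  case empty
  then show ?case by (cases ps rule: perm.cases) (auto intro: swap_eq.refl)
next
  case (insert x A)
  obtain rs y where r: "entries rs \<subseteq> insert x A - {x}" "swap_eq ps (rs @ [(x, y)])"
    using swap_eq_pull[OF insert.prems(1)] by blast
  then have id: "transpose x y \<circ> perm rs = id"
    using swap_eq_perm[OF r(2)] insert.prems(2) by (simp add: fun_eq_iff)
  have "perm rs x = x" by (rule perm_fixes) (use r in auto)
  then have "y = transpose x y (perm rs x)" by simp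
  then have "y = x" using id by (metis comp_apply id_apply)
  then have "perm rs = id" using id by simp
  then have "swap_eq rs []" using insert r by auto
  have "swap_eq ps (rs @ [])"
    using swap_eq.trans[OF r(2)] \<open>y = x\<close> swap_eq.append[OF swap_eq.refl[of rs] swap_eq.triv[of x]] by simp
  then show ?case using swap_eq.trans[OF _ \<open>swap_eq rs []\<close>] by simp
qed

lemma swap_eq_rev: "swap_eq (rev ps @ ps) []"
proof (induction ps)
  case (Cons a ps)
  obtain p q where "a = (p, q)" by fastforce
  have "swap_eq (rev ps @ [a, a] @ ps) (rev ps @ [] @ ps)"
    by (rule swap_eq_ctx) (simp add: \<open>a = (p, q)\<close> swap_eq.inv)
  then show ?case using swap_eq.trans[OF _ Cons] by simp
qed (simp add: swap_eq.refl)

lemma perm_eq_imp_swap_eq: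
  assumes "perm ps = perm qs"
  shows "swap_eq ps qs"
proof -
  have "swap_eq (qs @ rev qs) []" using swap_eq_rev[of "rev qs"] by simp
  then have "perm (ps @ rev qs) = id" using swap_eq_perm assms by fastforce
  then have "swap_eq (ps @ rev qs) []"
    using perm_id_imp_swap_eq[of "entries (ps @ rev qs)"] by (auto simp: entries_def)
  then have a: "swap_eq (ps @ rev qs @ qs) qs"
    using swap_eq.append[of "ps @ rev qs" "[]" qs qs] by (simp add: swap_eq.refl)
  have "swap_eq (ps @ rev qs @ qs) ps"
    using swap_eq.append[OF swap_eq.refl[of ps] swap_eq_rev[of qs]] by simp
  then show ?thesis by (rule swap_eq.trans[OF swap_eq.sym a])
qed

lemma bij_perm: "bij (perm ps)"
  by (induction ps rule: perm.induct) (simp_all add: bij_comp bij_id[unfolded id_def] del: comp_apply)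

lemma permutes_imp_perm:
  assumes "finite A" "\<pi> permutes A"
  shows "\<exists>ps. entries ps \<subseteq> A \<and> perm ps = \<pi>"
  using assms
proof (induction rule: permutes_rev_induct)
  case id
  show ?case by (intro exI[of _ "[]"]) auto
next
  case (swap a b \<pi>)
  then obtain ps where "entries ps \<subseteq> A" "perm ps = \<pi>" by blast
  with swap show ?case by (intro exI[of _ "(a, b) # ps"]) auto
qed

section \<open>Permutations acting on words with a hole\<close>

text \<open>The transposition of \<open>p\<close> and \<open>q\<close>, carried out with \<open>h\<close> as a hole; the hole moves along, from
  \<open>h\<close> to \<open>transpose p q h\<close>.\<close>

definition hole_swap :: "'n \<Rightarrow> 'n \<Rightarrow> 'n \<Rightarrow> ('n, 'a::monoid_mult) wmon" where
  "hole_swap h p q = (if p = q then 1 else if h = p then gen1 p q else if h = q then gen1 q p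
     else gen1 h p * gen1 p q * gen1 q h)"

fun hole_swaps :: "'n \<Rightarrow> ('n \<times> 'n) list \<Rightarrow> ('n, 'a::monoid_mult) wmon" where
  "hole_swaps h [] = 1"
| "hole_swaps h ((p, q) # ps) = hole_swap h p q * hole_swaps (transpose p q h) ps"

lemma hole_swaps_append: "hole_swaps h (ps @ qs) = hole_swaps h ps * hole_swaps (perm ps h) qs"
  by (induction h ps rule: hole_swaps.induct) (auto simp: mult.assoc)

lemma hole_after_swap:
  assumes "hole h u"
  shows "hole (transpose p q h) (u * hole_swap h p q)"
  using assms hole_gen[of p q u] hole_gen[of q p u] hole_gen[of q h "u * gen1 h p * gen1 p q"]
  by (auto simp: hole_swap_def mult.assoc[symmetric])

lemma hole_after_swaps: "hole h u \<Longrightarrow> hole (perm ps h) (u * hole_swaps h ps)"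
proof (induction ps arbitrary: h u)
  case (Cons a ps)
  obtain p q where "a = (p, q)" by fastforce
  then show ?case using Cons.IH[OF hole_after_swap[OF Cons.prems, of p q]] by (simp add: mult.assoc)
qed auto

text \<open>This makes permutations act on elements with a hole: each relation of
  \<open>swap_eq\<close> is checked for every position of \<open>h\<close> relative to the points
  involved. Both \<open>u\<close> and \<open>h\<close> vary in the induction because the first
  factor moves the hole.\<close>

lemma swap_eq_hole_swaps_eq:
  fixes u :: "('n, 'a::monoid_mult) wmon"
  assumes "swap_eq ps qs" "hole h u"
  shows "u * hole_swaps h ps = u * hole_swaps h qs"
  using assms
proof (induction arbitrary: u h rule: swap_eq.induct)
  case (append ps qs ps' qs')
  have "u * hole_swaps h (ps @ ps') = u * hole_swaps h qs * hole_swaps (perm ps h) ps'"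
    using append by (simp add: hole_swaps_append mult.assoc[symmetric])
  also have "\<dots> = u * hole_swaps h qs * hole_swaps (perm qs h) qs'"
    using append swap_eq_perm[OF append(1)] hole_after_swaps[OF append(5), of qs] by auto
  finally show ?case by (simp add: hole_swaps_append mult.assoc)
next
  case (triv p)
  then show ?case by (simp add: hole_swap_def)
next
  case (inv p q)
  consider "p = q" | "h = p" "p \<noteq> q" | "h = q" "p \<noteq> q" | "distinct [h, p, q]" by auto
  then show ?case
  proof cases
    case 4
    \<comment> \<open>Running the first loop in the opposite direction puts mutually inverse moves
      next to each other, and the product collapses from the middle.\<close>
    have "u * hole_swap h p q * hole_swap h p q
        = u * gen1 h p * gen1 p q * gen1 q h * gen1 h p * gen1 p q * gen1 q h"
      using 4 by (simp add: hole_swap_def mult.assoc)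
    also have "\<dots> = u * gen1 h q * gen1 q p * gen1 p h * gen1 h p * gen1 p q * gen1 q h"
      using hole_loop3[OF inv 4] by simp
    also have "\<dots> = u * gen1 h q * gen1 q p * gen1 p q * gen1 q h"
      using hole_move_cancel[OF hole_gen, of q p h "u * gen1 h q"] 4 by auto
    also have "\<dots> = u * gen1 h q * gen1 q h"
      using hole_move_cancel[OF hole_gen, of h q p u] 4 by auto
    also have "\<dots> = u"
      using hole_move_cancel[OF inv, of q] 4 by auto
    finally show ?thesis using 4 by (simp add: mult.assoc)
  qed (use inv hole_move_cancel[of h u p] hole_move_cancel[of h u q] in
      \<open>auto simp: hole_swap_def mult.assoc[symmetric]\<close>)
next
  case (flip p q)
  then show ?case using hole_loop3[of h u p q] by (auto simp: hole_swap_def mult.assoc[symmetric])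
next
  case (conj p q r)
  consider "h = p" | "h = q" | "h = r" | "distinct [h, p, q, r]" using conj by auto
  then show ?case
  proof cases
    case 1
    have "u * gen1 p q * gen1 q r * gen1 r p * gen1 p r = u * gen1 p q * gen1 q r"
      using hole_move_cancel[OF hole_gen, of q r p "u * gen1 p q"] conj by auto
    then show ?thesis using conj 1 by (auto simp: hole_swap_def mult.assoc)
  next
    case 2
    then show ?thesis using hole_move_cancel[OF conj(2), of p] conj(1)
      by (auto simp: hole_swap_def mult.assoc[symmetric])
  next
    case 3
    have "u * gen1 r p * gen1 p q * gen1 q r * gen1 r q = u * gen1 r p * gen1 p q"
      using hole_move_cancel[OF hole_gen, of p q r "u * gen1 r p"] conj by auto
    moreover have "u * gen1 r q * gen1 q p * gen1 p r * gen1 r q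
        = u * gen1 r p * gen1 p q * gen1 q r * gen1 r q"
      using hole_loop3[of r u q p] conj 3 by auto
    ultimately show ?thesis using conj 3 by (auto simp: hole_swap_def mult.assoc[symmetric])
  next
    case 4
    have "u * gen1 h p * gen1 p q * gen1 q h * gen1 h q * gen1 q r * gen1 r h
        = u * gen1 h p * gen1 p q * gen1 q r * gen1 r h"
      using hole_move_cancel[OF hole_gen, of p q h "u * gen1 h p"] 4 by auto
    also have "\<dots> = u * gen1 h q * gen1 q r * gen1 r h * gen1 h p * gen1 p r * gen1 r h"
      using hole_loop4[OF conj(2) 4] by simp
    finally show ?thesis using 4 by (auto simp: hole_swap_def mult.assoc[symmetric])
  qed
qed auto

section \<open>Merges, moves and several holes\<close>

lemma gen1_tree:
  fixes u :: "('n, 'a::monoid_mult) wmon"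
  shows "distinct [i, j, k] \<Longrightarrow> u * gen1 j k * gen1 i j = u * gen1 i j * gen1 i k"
  using gen_tree1[of i j k "1 :: 'a" 1 1 1] gen_tree2[of i j k "1 :: 'a" 1 1 1] by (simp add: mult.assoc)

lemma gen1_commute:
  fixes u :: "('n, 'a::monoid_mult) wmon"
  assumes "i \<noteq> j" "k \<noteq> l" "i \<noteq> l" "k \<noteq> j" "j \<noteq> l"
  shows "u * gen1 i j * gen1 k l = u * gen1 k l * gen1 i j"
proof (cases "i = k")
  case True
  then show ?thesis
    using assms gen_fan1[of i j l "1 :: 'a" 1 1 1] by (simp add: mult.assoc)
next
  case False
  then show ?thesis using assms by (simp add: mult.assoc gen_commute)
qed

lemma two_holes_move:
  assumes "hole h u" "hole h' u" "distinct [h, h', p]"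
  shows "u * gen1 h' p = u * gen1 h p * gen1 h' h"
proof -
  have "u * gen1 h p * gen1 h' h = u * gen1 h' p * gen1 h' h"
    using gen1_tree[of h' h p u] gen1_commute[of h' h h' p u] assms by auto
  also have "\<dots> = u * gen1 h' p"
    using assms by (intro holeD hole_persists) auto
  finally show ?thesis ..
qed

text \<open>If a hole is one of the points exchanged, its swap is a single move and is compared
  directly with the loop through the other hole. If neither is, one loop is rerouted.\<close>

lemma two_holes_hole_swap:
  fixes u :: "('n, 'a::monoid_mult) wmon"
  assumes "hole h u" "hole h' u"
  shows "u * hole_swap h p q = u * hole_swap h' p q"
proof -
  have *: "u * gen1 h q = u * hole_swap h' h q"
    if "hole h u" "hole h' u" "h \<noteq> h'" "q \<noteq> h" for h h' q and u :: "('n, 'a) wmon"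
  proof (cases "q = h'")
    case True
    then show ?thesis using that holeD[of h u h' 1] holeD[of h' u h 1] by (auto simp: hole_swap_def)
  next
    case False
    have "u * hole_swap h' h q = u * gen1 h' h * gen1 h q * gen1 q h'"
      using that False by (simp add: hole_swap_def mult.assoc)
    also have "\<dots> = u * gen1 h q * gen1 q h'" using that holeD[of h u h' 1] by simp
    also have "\<dots> = u * gen1 h q" using that False by (intro holeD hole_persists) auto
    finally show ?thesis ..
  qed
  have flip: "u * hole_swap h p q = u * hole_swap h q p" if "hole h u" for h
    using swap_eq_hole_swaps_eq[OF swap_eq.flip[of p q] that] by simp
  consider "p = q" | "h = h'" | "p \<noteq> q" "h \<noteq> h'" "h = p" | "p \<noteq> q" "h \<noteq> h'" "h' = p"
    | "p \<noteq> q" "h \<noteq> h'" "h = q" | "p \<noteq> q" "h \<noteq> h'" "h' = q" | "distinct [h, h', p, q]"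
    by auto
  then show ?thesis
  proof cases
    case 7
    have u1: "hole p (u * gen1 h p)" "hole h' (u * gen1 h p)"
      using assms 7 by (auto intro!: hole_gen hole_persists)
    have u2: "hole q (u * gen1 h p * gen1 p q)" "hole h' (u * gen1 h p * gen1 p q)"
      using u1 7 by (auto intro!: hole_gen hole_persists)
    \<comment> \<open>The token at \<open>p\<close> goes to \<open>h\<close> first; its transfer
      from \<open>h\<close> to \<open>h'\<close> is postponed and combined with the last move, which
      then leads from \<open>h\<close> straight to \<open>q\<close>.\<close>
    have "u * hole_swap h' p q = u * gen1 h' p * gen1 p q * gen1 q h'"
      using 7 by (auto simp: hole_swap_def mult.assoc)
    also have "\<dots> = u * gen1 h p * gen1 h' h * gen1 p q * gen1 q h'"
      using two_holes_move[OF assms] 7 by simp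
    also have "\<dots> = u * gen1 h p * gen1 p q * gen1 h' h * gen1 q h'"
      using gen1_commute[of h' h p q "u * gen1 h p"] 7 by auto
    also have "\<dots> = u * gen1 h p * gen1 p q * gen1 q h * gen1 q h'"
      using gen1_tree[of q h' h "u * gen1 h p * gen1 p q"]
        gen1_commute[of q h' q h "u * gen1 h p * gen1 p q"] 7 by auto
    also have "\<dots> = u * gen1 h p * gen1 p q * gen1 q h"
      using holeD[OF hole_persists[OF u2(2), of q h 1 1], of q 1] 7 by auto
    also have "\<dots> = u * hole_swap h p q"
      using 7 by (auto simp: hole_swap_def mult.assoc)
    finally show ?thesis ..
  next
    case 3
    then have "hole_swap h p q = (gen1 h q :: ('n, 'a) wmon)" by (simp add: hole_swap_def)
    then show ?thesis using *[OF assms, of q] 3 by simp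
  next
    case 4
    then have "hole_swap h' p q = (gen1 h' q :: ('n, 'a) wmon)" by (simp add: hole_swap_def)
    then show ?thesis using *[OF assms(2,1), of q] 4 by simp
  next
    case 5
    then have "hole_swap h p q = (gen1 h p :: ('n, 'a) wmon)" by (simp add: hole_swap_def)
    then show ?thesis using *[OF assms, of p] flip[OF assms(2)] 5 by simp
  next
    case 6
    then have "hole_swap h' p q = (gen1 h' p :: ('n, 'a) wmon)" by (simp add: hole_swap_def)
    then show ?thesis using *[OF assms(2,1), of p] flip[OF assms(1)] 6 by simp
  qed (simp_all add: hole_swap_def)
qed

lemma two_holes_hole_swaps:
  assumes "hole h u" "hole h' u"
  shows "u * hole_swaps h ps = u * hole_swaps h' ps"
  using assms
proof (induction ps arbitrary: u h h')
  case (Cons a ps)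
  obtain p q where a: "a = (p, q)" by fastforce
  have eq: "u * hole_swap h p q = u * hole_swap h' p q" using two_holes_hole_swap Cons.prems by metis
  have "u * hole_swap h p q * hole_swaps (transpose p q h) ps = u * hole_swap h p q * hole_swaps (transpose p q h') ps"
    using hole_after_swap[OF Cons.prems(1), of p q] hole_after_swap[OF Cons.prems(2), of p q] eq
    by (intro Cons.IH) auto
  then show ?case using a eq by (simp add: mult.assoc[symmetric])
qed simp

text \<open>The case of \<open>hole_swap_gen1\<close> in which the hole is one of the exchanged
  points, so that the swap is a single move. On the right the merge comes first, hence
  \<open>l\<close> is a hole and serves in place of \<open>h\<close>.\<close>

lemma hole_swap_gen1_hole:
  assumes "hole h u" "q \<noteq> h" "k \<noteq> l"
  shows "u * gen1 h q * gen1 (transpose h q k) (transpose h q l) = u * gen1 k l * hole_swap l h q"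
proof -
  note holeD[OF assms(1), simp]
  consider "l = q" "k = h" | "l = q" "k \<noteq> h" | "l = h" "k = q" | "l = h" "k \<noteq> q"
    | "l \<noteq> h" "l \<noteq> q" "k = h" | "l \<noteq> h" "l \<noteq> q" "k = q" | "distinct [h, q, k, l]"
    using assms by auto
  then show ?thesis
  proof cases
    case 1
    then show ?thesis using assms by (auto simp: hole_swap_def)
  next
    case 2
    have "hole h (u * gen1 k q)" using 2 assms by (intro hole_persists) auto
    note h = holeD[OF this, of _ 1]
    have "u * gen1 h q * gen1 k h = u * gen1 k q * gen1 k h"
      using gen1_tree[of k h q u] gen1_commute[of k h k q u] 2 assms by auto
    also have "\<dots> = u * gen1 k q * gen1 q h"
      using h[of k] h[of q] 2 assms by simp
    finally show ?thesis using 2 assms by (auto simp: hole_swap_def)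
  next
    case 3
    then show ?thesis using assms by (auto simp: hole_swap_def mult.assoc gen_mult)
  next
    case 4
    have "u * gen1 h q * gen1 k q = u * gen1 h q"
      using 4 assms by (intro holeD hole_gen) auto
    then show ?thesis using 4 assms by (auto simp: hole_swap_def)
  next
    case 5
    then show ?thesis using assms hole_move_cancel[OF assms(1), of l]
      by (auto simp: hole_swap_def mult.assoc[symmetric])
  next
    case 6
    have "u * gen1 q l * hole_swap l h q = u * gen1 q l * hole_swap h h q"
      using 6 assms by (intro two_holes_hole_swap hole_gen hole_persists) auto
    also have "\<dots> = u * gen1 h q * gen1 h l"
      using 6 assms gen1_tree[of h q l u] by (auto simp: hole_swap_def)
    finally show ?thesis using 6 by simp
  next
    case 7
    have "u * gen1 k l * hole_swap l h q = u * gen1 k l * hole_swap h h q"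
      using 7 assms by (intro two_holes_hole_swap hole_gen hole_persists) auto
    also have "\<dots> = u * gen1 h q * gen1 k l"
      using 7 gen1_commute[of h q k l u] by (auto simp: hole_swap_def)
    finally show ?thesis using 7 by auto
  qed
qed

text \<open>Conjugation of a merge by a transposition, the device that collects all permutations at
  the right end of a word.\<close>

lemma hole_swap_gen1:
  assumes "hole h u" "k \<noteq> l"
  shows "u * hole_swap h p q * gen1 (transpose p q k) (transpose p q l) = u * gen1 k l * hole_swap l p q"
proof -
  consider "p = q" | "p \<noteq> q" "h = p" | "p \<noteq> q" "h = q" | "distinct [h, p, q]" by auto
  then show ?thesis
  proof cases
    case 1
    then show ?thesis by (simp add: hole_swap_def)
  next
    case 2
    then show ?thesis using hole_swap_gen1_hole[OF assms(1), of q k l] assms by (simp add: hole_swap_def)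
  next
    case 3
    have "u * gen1 k l * hole_swap l q p = u * gen1 k l * hole_swap l p q"
      using swap_eq_hole_swaps_eq[OF swap_eq.flip[of q p] hole_gen[OF assms(2)], of u 1 1] by simp
    then show ?thesis
      using hole_swap_gen1_hole[OF assms(1), of p k l] 3 assms
      by (simp add: hole_swap_def transpose_commute[of p q])
  next
    case 4
    let ?f = "transpose h p" and ?g = "transpose p q" and ?h = "transpose q h"
    have neq: "?f k \<noteq> ?f l" "?g (?f k) \<noteq> ?g (?f l)"
      using assms(2) by (auto dest: transpose_eq_imp_eq)
    \<comment> \<open>The loop through \<open>h\<close> consists of the swaps (h p), (p q), (q h),
      each made at the current hole, with product (p q). The merge passes them one by one, and the
      resulting product at hole \<open>l\<close> contracts by
      \<open>perm_eq_imp_swap_eq\<close>.\<close>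
    have perm: "perm [(h, p), (p, q), (q, h)] = perm [(p, q)]"
      using 4 by (auto simp: fun_eq_iff transpose_def)
    then have t: "?h (?g (?f x)) = ?g x" for x by (auto simp: fun_eq_iff)
    have h1: "hole p (u * gen1 h p)" using 4 by (auto intro: hole_gen)
    have h2: "hole q (u * gen1 h p * gen1 p q)" using 4 by (auto intro: hole_gen)
    have "u * hole_swap h p q * gen1 (?g k) (?g l)
        = u * gen1 h p * gen1 p q * gen1 q h * gen1 (?h (?g (?f k))) (?h (?g (?f l)))"
      using 4 t by (simp add: hole_swap_def mult.assoc)
    also have "\<dots> = u * gen1 h p * gen1 p q * gen1 (?g (?f k)) (?g (?f l)) * hole_swap (?g (?f l)) q h"
      using hole_swap_gen1_hole[OF h2 _ neq(2), of h] 4 by auto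
    also have "\<dots> = u * gen1 h p * gen1 (?f k) (?f l) * hole_swap (?f l) p q * hole_swap (?g (?f l)) q h"
      using hole_swap_gen1_hole[OF h1 _ neq(1), of q] 4 by auto
    also have "\<dots> = u * gen1 k l * hole_swap l h p * hole_swap (?f l) p q * hole_swap (?g (?f l)) q h"
      using hole_swap_gen1_hole[OF assms(1) _ assms(2), of p] 4 by auto
    also have "\<dots> = u * gen1 k l * hole_swaps l [(h, p), (p, q), (q, h)]"
      by (simp add: mult.assoc)
    also have "\<dots> = u * gen1 k l * hole_swaps l [(p, q)]"
      using perm assms(2) by (intro swap_eq_hole_swaps_eq perm_eq_imp_swap_eq hole_gen)
    finally show ?thesis by simp
  qed
qed

lemma hole_swaps_gen1:
  assumes "hole h u" "k \<noteq> l"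
  shows "u * hole_swaps h ps * gen1 (perm ps k) (perm ps l) = u * gen1 k l * hole_swaps l ps"
  using assms
proof (induction ps arbitrary: u h k l)
  case (Cons a ps)
  obtain p q where a: "a = (p, q)" by fastforce
  have "u * hole_swaps h (a # ps) * gen1 (perm (a # ps) k) (perm (a # ps) l)
      = u * hole_swap h p q * gen1 (transpose p q k) (transpose p q l) * hole_swaps (transpose p q l) ps"
    using Cons.IH[OF hole_after_swap[OF Cons.prems(1), of p q], of "transpose p q k" "transpose p q l"]
      Cons.prems(2) a
    by (auto simp: mult.assoc dest: transpose_eq_imp_eq)
  also have "\<dots> = u * gen1 k l * hole_swaps l (a # ps)"
    using hole_swap_gen1[OF Cons.prems, of p q] a by (simp add: mult.assoc[symmetric])
  finally show ?case .
qed simp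

section \<open>Evaluation in the wreath product\<close>

lemma wreath_mult_assoc: "wreath_mult (wreath_mult x y) z = wreath_mult x (wreath_mult y z)"
  by (cases x; cases y; cases z) (simp add: o_assoc mult.assoc)

text \<open>Unlike \<open>phi2\<close>, this gives the empty word the identity, so it descends to a
  homomorphism on the whole monoid \<open>wmon\<close>; on non-empty words the two agree.\<close>

fun word_val :: "('n, 'a::monoid_mult) letter list \<Rightarrow> ('n \<Rightarrow> 'a) \<times> ('n \<Rightarrow> 'n)" where
  "word_val [] = (\<lambda>i. 1, id)"
| "word_val (x # w) = wreath_mult (letter_val x) (word_val w)"

lemma wreath_mult_one [simp]:
  "wreath_mult (\<lambda>i. 1, id) x = x" "wreath_mult x (\<lambda>i. 1, id) = x"
  by (cases x; simp)+

lemma word_val_append: "word_val (u @ v) = wreath_mult (word_val u) (word_val v)"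
  by (induction u) (simp_all add: wreath_mult_assoc)

lemma R2_sound: "(l, r) \<in> R2 \<Longrightarrow> word_val l = word_val r"
  by (cases rule: R2.cases) (auto simp: fun_eq_iff eps_wr_def eps_def)

lemma eqv_sound: "eqv u v \<Longrightarrow> word_val u = word_val v"
  by (induction rule: eqv.induct) (auto simp: word_val_append dest: R2_sound)

lift_definition val :: "('n, 'a::monoid_mult) wmon \<Rightarrow> ('n \<Rightarrow> 'a) \<times> ('n \<Rightarrow> 'n)" is word_val
  by (rule eqv_sound)

lemma val_one [simp]: "val 1 = (\<lambda>i. 1, id)"
  by transfer simp

lemma val_mult: "val (x * y) = wreath_mult (val x) (val y)"
  by transfer (rule word_val_append)

lemma val_gen [simp]: "val (gen i j a b) = eps_wr i j a b"
  by transfer (simp add: eps_wr_def)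

definition to_map :: "('n, 'a::monoid_mult) wmon \<Rightarrow> 'n \<Rightarrow> 'n" where
  "to_map x = snd (val x)"

lemma to_map_simps [simp]:
  "to_map 1 = id"
  "to_map (x * y) = to_map y \<circ> to_map x"
  "to_map (gen i j a b) = eps i j"
  by (cases "val x"; cases "val y"; simp add: to_map_def val_mult eps_wr_def)+

text \<open>The hole has to be excluded: for \<open>h\<close>, \<open>p\<close>, \<open>q\<close>
  distinct the loop sends both \<open>h\<close> and \<open>p\<close> to \<open>q\<close>.\<close>

lemma to_map_hole_swap: "x \<noteq> h \<Longrightarrow> to_map (hole_swap h p q) x = transpose p q x"
  by (auto simp: hole_swap_def eps_def transpose_def)

lemma to_map_hole_swaps: "x \<noteq> h \<Longrightarrow> to_map (hole_swaps h ps) x = perm ps x"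
proof (induction ps arbitrary: x h)
  case (Cons a ps)
  obtain p q where a: "a = (p, q)" by fastforce
  have "transpose p q x \<noteq> transpose p q h"
    using Cons.prems by (auto dest: transpose_eq_imp_eq)
  then show ?case using Cons a by (simp add: to_map_hole_swap)
qed simp

section \<open>Words without labels\<close>

definition merges :: "('n \<times> 'n) list \<Rightarrow> ('n, 'a::monoid_mult) wmon" where
  "merges w = prod_list (map (\<lambda>(i, j). gen1 i j) w)"

lemma merges_simps [simp]:
  "merges [] = 1"
  "merges ((i, j) # w) = gen1 i j * merges w"
  "merges (v @ w) = merges v * merges w"
  by (simp_all add: merges_def)

text \<open>Then \<open>merges L\<close> is the idempotent sending \<open>j\<close> to \<open>i\<close> for \<open>(i, j) \<in> set L\<close> and fixing all other
  points.\<close>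

definition proj :: "('n \<times> 'n) list \<Rightarrow> bool" where
  "proj L \<longleftrightarrow> distinct (map snd L) \<and> fst ` set L \<inter> snd ` set L = {}"

lemma merges_commute:
  assumes "\<And>k l. (k, l) \<in> set L \<Longrightarrow> i \<noteq> l \<and> k \<noteq> j \<and> j \<noteq> l \<and> k \<noteq> l" "i \<noteq> j"
  shows "merges L * gen1 i j = gen1 i j * (merges L :: ('n, 'a::monoid_mult) wmon)"
  using assms(1)
proof (induction L)
  case (Cons a L)
  obtain k l where a: "a = (k, l)" by fastforce
  have IH: "merges L * gen1 i j = gen1 i j * (merges L :: ('n, 'a) wmon)"
    by (rule Cons.IH) (use Cons.prems in auto)
  have "merges (a # L) * gen1 i j = gen1 k l * ((merges L :: ('n, 'a) wmon) * gen1 i j)" using a by (simp add: mult.assoc)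
  also have "\<dots> = gen1 k l * gen1 i j * merges L" by (simp only: IH mult.assoc)
  also have "gen1 k l * gen1 i j = gen1 i j * (gen1 k l :: ('n, 'a) wmon)"
    using gen1_commute[of k l i j 1] Cons.prems[of k l] a assms(2) by auto
  finally show ?case using a by (simp add: mult.assoc)
qed simp

lemma projD:
  assumes "proj L" "(i, j) \<in> set L"
  shows "i \<notin> snd ` set L" "j \<notin> fst ` set L" "i \<noteq> j"
  using assms image_eqI[of i fst "(i, j)" "set L"] image_eqI[of j snd "(i, j)" "set L"]
  unfolding proj_def by auto

text \<open>The second components are distinct and never occur as first components, so all letters
  commute and any one of them can be taken to either end.\<close>

lemma proj_split:
  assumes "proj L" "(i, j) \<in> set L"
  obtains L' where "proj L'" "set L' = set L - {(i, j)}"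
    "merges L = gen1 i j * (merges L' :: ('n, 'a::monoid_mult) wmon)"
    "merges L = (merges L' :: ('n, 'a::monoid_mult) wmon) * gen1 i j"
proof -
  obtain L1 L2 where L: "L = L1 @ (i, j) # L2" using assms split_list by metis
  have d: "j \<notin> snd ` (set L1 \<union> set L2)" using assms(1) by (auto simp: proj_def L)
  have *: "i \<noteq> l \<and> k \<noteq> j \<and> j \<noteq> l \<and> k \<noteq> l" if "(k, l) \<in> set L1 \<union> set L2" for k l
  proof -
    have "(k, l) \<in> set L" using that by (auto simp: L)
    moreover have "j \<noteq> l" using d that by (metis image_eqI snd_conv)
    ultimately show ?thesis
      using projD[OF assms] projD[OF assms(1), of k l] by (metis fst_conv image_eqI snd_conv)
  qed
  have ij: "i \<noteq> j" using projD[OF assms] by simp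
  have c1: "merges L1 * gen1 i j = gen1 i j * (merges L1 :: ('n, 'a) wmon)"
    by (rule merges_commute) (use * ij in auto)
  have c2: "merges L2 * gen1 i j = gen1 i j * (merges L2 :: ('n, 'a) wmon)"
    by (rule merges_commute) (use * ij in auto)
  have "proj (L1 @ L2)" using assms(1) by (auto simp: proj_def L)
  moreover have "set (L1 @ L2) = set L - {(i, j)}" using d by (force simp: L)
  moreover have "merges L = merges L1 * gen1 i j * (merges L2 :: ('n, 'a) wmon)" by (simp add: L mult.assoc)
  then have "merges L = gen1 i j * (merges (L1 @ L2) :: ('n, 'a) wmon)" by (simp add: c1 mult.assoc)
  moreover have "merges L = (merges (L1 @ L2) :: ('n, 'a) wmon) * gen1 i j" by (simp add: L mult.assoc c2)
  ultimately show ?thesis by (rule that)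
qed

lemma proj_hole:
  assumes "proj L" "j \<in> snd ` set L"
  shows "hole j (merges L)"
proof -
  obtain i where ij: "(i, j) \<in> set L" using assms by auto
  then have "i \<noteq> j" using projD[OF assms(1)] by simp
  then show ?thesis using proj_split[OF assms(1) ij] hole_gen by metis
qed

lemma to_map_merges_id: "j \<notin> snd ` set L \<Longrightarrow> to_map (merges L :: ('n, 'a::monoid_mult) wmon) j = j"
proof (induction L)
  case (Cons a L)
  then show ?case by (cases a) (auto simp: eps_def)
qed simp

lemma to_map_merges_proj:
  assumes "proj L" "(i, j) \<in> set L"
  shows "to_map (merges L :: ('n, 'a::monoid_mult) wmon) j = i"
proof -
  obtain L' where L': "set L' = set L - {(i, j)}"
    "merges L = gen1 i j * (merges L' :: ('n, 'a::monoid_mult) wmon)"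
    using proj_split[OF assms] by metis
  have "i \<notin> snd ` set L'" using projD[OF assms] L'(1) by auto
  then show ?thesis using L'(2) to_map_merges_id[of i L'] by (simp add: eps_def)
qed

lemma to_map_merges_notin:
  assumes "proj L"
  shows "to_map (merges L :: ('n, 'a::monoid_mult) wmon) x \<notin> snd ` set L"
proof (cases "x \<in> snd ` set L")
  case True
  then obtain i where ix: "(i, x) \<in> set L" by auto
  then have "i \<notin> snd ` set L" using projD[OF assms] by simp
  then show ?thesis using to_map_merges_proj[OF assms ix, where 'a = 'a] by simp
next
  case False
  then show ?thesis by (simp add: to_map_merges_id)
qed

text \<open>A letter of \<open>L\<close> onto \<open>q\<close> becomes one onto \<open>p\<close> by
  the tree relation, since \<open>q\<close> is itself merged into \<open>p\<close>; all other
  letters commute with \<open>gen1 p q\<close>.\<close>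

lemma merges_merge:
  assumes "\<And>i j. (i, j) \<in> set L \<Longrightarrow> i \<noteq> j \<and> j \<noteq> p \<and> j \<noteq> q" "p \<noteq> q"
  shows "merges L * gen1 p q
    = gen1 p q * (merges (map (\<lambda>(i, j). (if i = q then p else i, j)) L) :: ('n, 'a::monoid_mult) wmon)"
  using assms(1)
proof (induction L)
  case (Cons a L)
  obtain i j where a: "a = (i, j)" by fastforce
  let ?m = "\<lambda>L. merges (map (\<lambda>(i, j). (if i = q then p else i, j)) L) :: ('n, 'a) wmon"
  have IH: "merges L * gen1 p q = gen1 p q * ?m L"
    by (rule Cons.IH) (use Cons.prems in auto)
  have "merges (a # L) * gen1 p q = gen1 i j * ((merges L :: ('n, 'a) wmon) * gen1 p q)" using a by (simp add: mult.assoc)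
  also have "\<dots> = gen1 i j * gen1 p q * ?m L" by (simp only: IH mult.assoc)
  also have "gen1 i j * gen1 p q = gen1 p q * (gen1 (if i = q then p else i) j :: ('n, 'a) wmon)"
    using gen1_tree[of p q j 1] gen1_commute[of i j p q 1] Cons.prems[of i j] a assms(2) by auto
  finally show ?case using a by (simp add: mult.assoc)
qed simp

text \<open>If exactly one of \<open>i\<close>, \<open>j\<close> is a class representative, the pair
  is, up to order, a letter of \<open>L\<close> and is brought to the front. If neither is, both go
  to some \<open>r\<close>, and the tree relation trades \<open>gen1 i j\<close> for a repeated
  \<open>gen1 r j\<close>.\<close>

lemma proj_left_absorb:
  assumes "proj L" "to_map (merges L :: ('n, 'a::monoid_mult) wmon) i = to_map (merges L :: ('n, 'a) wmon) j"
    "i \<noteq> j"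
  shows "gen1 i j * merges L = (merges L :: ('n, 'a::monoid_mult) wmon)"
proof -
  consider "i \<notin> snd ` set L" "j \<notin> snd ` set L" | "i \<notin> snd ` set L" "j \<in> snd ` set L"
    | "i \<in> snd ` set L" "j \<notin> snd ` set L" | "i \<in> snd ` set L" "j \<in> snd ` set L" by blast
  then show ?thesis
  proof cases
    case 1
    then show ?thesis using assms by (simp add: to_map_merges_id)
  next
    case 2
    then obtain r where r: "(r, j) \<in> set L" by auto
    then have ij: "(i, j) \<in> set L"
      using 2 assms to_map_merges_proj[OF assms(1) r, where 'a = 'a] by (simp add: to_map_merges_id)
    obtain L' where L': "merges L = gen1 i j * (merges L' :: ('n, 'a::monoid_mult) wmon)"
      using proj_split[OF assms(1) ij] by metis
    show ?thesis
      unfolding L' using assms(3) by (simp add: mult.assoc[symmetric] gen_mult)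
  next
    case 3
    then obtain r where r: "(r, i) \<in> set L" by auto
    then have ij: "(j, i) \<in> set L"
      using 3 assms to_map_merges_proj[OF assms(1) r, where 'a = 'a] by (simp add: to_map_merges_id)
    obtain L' where L': "merges L = gen1 j i * (merges L' :: ('n, 'a::monoid_mult) wmon)"
      using proj_split[OF assms(1) ij] by metis
    show ?thesis
      unfolding L' using assms(3) by (simp add: mult.assoc[symmetric] gen_mult_swap)
  next
    case 4
    then obtain r where r: "(r, i) \<in> set L" by auto
    from 4 obtain r' where "(r', j) \<in> set L" by auto
    then have r': "(r, j) \<in> set L"
      using assms to_map_merges_proj[OF assms(1), where 'a = 'a] r by metis
    obtain L' where L': "proj L'" "set L' = set L - {(r, i)}"
      "merges L = gen1 r i * (merges L' :: ('n, 'a::monoid_mult) wmon)"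
      using proj_split[OF assms(1) r] by metis
    then have "(r, j) \<in> set L'" using r' assms by auto
    then obtain L'' where L'': "merges L' = gen1 r j * (merges L'' :: ('n, 'a::monoid_mult) wmon)"
      using proj_split[OF L'(1)] by metis
    have "r \<noteq> i" "r \<noteq> j" using projD[OF assms(1)] r r' by auto
    then have "gen1 i j * gen1 r i = gen1 r i * (gen1 r j :: ('n, 'a) wmon)"
      using gen1_tree[of r i j 1] assms(3) by auto
    then have "gen1 i j * merges L = gen1 r i * (gen1 r j * gen1 r j) * (merges L'' :: ('n, 'a) wmon)"
      using L' L'' by (simp add: mult.assoc) (simp add: mult.assoc[symmetric])
    also have "\<dots> = merges L"
      using L' L'' \<open>r \<noteq> j\<close> by (simp add: gen_mult mult.assoc)
    finally show ?thesis .
  qed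
qed

text \<open>The two permutations differ by a permutation of the holes. Written in front, it acts on
  \<open>u\<close> itself, where exchanging two empty positions changes nothing.\<close>

lemma hole_swaps_eq_off_holes:
  fixes u :: "('n::finite, 'a::monoid_mult) wmon"
  assumes "\<And>j. j \<in> H \<Longrightarrow> hole j u" "h \<in> H" "h' \<in> H"
    "\<And>k. k \<notin> H \<Longrightarrow> perm ps k = perm qs k"
  shows "u * hole_swaps h ps = u * hole_swaps h' qs"
proof -
  let ?\<pi> = "inv (perm qs) \<circ> perm ps"
  have b: "bij (perm qs)" "bij (perm ps)" by (rule bij_perm)+
  have "bij ?\<pi>" using b by (intro bij_comp bij_imp_bij_inv)
  moreover have "?\<pi> k = k" if "k \<notin> H" for k
    using assms(4)[OF that] b by (simp add: bij_is_inj)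
  ultimately have "?\<pi> permutes H" by (simp add: permutes_def bij_iff)
  then obtain rs where rs: "entries rs \<subseteq> H" "perm rs = ?\<pi>"
    using permutes_imp_perm[of H] by auto
  have "perm ps x = perm (rs @ qs) x" for x
    using rs(2) surj_f_inv_f[OF bij_is_surj[OF b(1)]] by simp
  then have "perm ps = perm (rs @ qs)" by (rule ext)
  then have "u * hole_swaps h ps = u * hole_swaps h (rs @ qs)"
    using assms(1,2) by (intro swap_eq_hole_swaps_eq perm_eq_imp_swap_eq)
  then have "u * hole_swaps h ps = u * hole_swaps h rs * hole_swaps (perm rs h) qs"
    by (simp add: hole_swaps_append mult.assoc)
  moreover have "u * hole_swaps h rs = u \<and> perm rs h \<in> H" if "h \<in> H" for h
    using rs(1) that
  proof (induction rs arbitrary: h)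
    case (Cons a rs)
    obtain p q where a: "a = (p, q)" by fastforce
    have pq: "p \<in> H" "q \<in> H" using Cons.prems a by auto
    \<comment> \<open>With \<open>p\<close> itself as the hole, the swap is trivial or the single
      letter \<open>gen1 p q\<close>, which the hole \<open>q\<close> absorbs.\<close>
    have "u * hole_swap h p q = u * hole_swap p p q" using assms(1) pq Cons.prems by (intro two_holes_hole_swap) auto
    also have "\<dots> = u" using holeD[OF assms(1)[OF pq(2)], of p 1] by (auto simp: hole_swap_def)
    finally have u: "u * hole_swap h p q = u" .
    have "transpose p q h \<in> H" using pq Cons.prems by (auto simp: transpose_def)
    then show ?case using Cons u a by (simp add: mult.assoc[symmetric])
  qed simp
  moreover from this have "u * hole_swaps (perm rs h) qs = u * hole_swaps h' qs"
    using assms by (intro two_holes_hole_swaps) auto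
  ultimately show ?thesis using assms by simp
qed

lemma hole_swaps_gen1_inv:
  assumes "hole h u" "i \<noteq> j"
  obtains p q where "p \<noteq> q" "u * hole_swaps h ps * gen1 i j = u * gen1 p q * hole_swaps q ps"
proof -
  have surj: "surj (perm ps)" by (rule bij_is_surj[OF bij_perm])
  obtain p q where "i = perm ps p" "j = perm ps q" using surjD[OF surj] by blast
  then show ?thesis using assms hole_swaps_gen1[of h u p q ps] that[of p q] by auto
qed

section \<open>Normal form and uniqueness for unlabelled words\<close>

definition proper :: "('n \<times> 'n) list \<Rightarrow> bool" where
  "proper w \<longleftrightarrow> (\<forall>(i, j) \<in> set w. i \<noteq> j)"

text \<open>A further letter is pulled to the left of the permutation and becomes
  \<open>gen1 p q\<close> right after \<open>merges L\<close>. If \<open>q\<close> is a hole it is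
  absorbed; if only \<open>p\<close> is, it is a move and joins the permutation; if neither is, it
  is a genuine merge and joins \<open>L\<close>.\<close>

lemma merges_normal_form:
  assumes "proper w" "w \<noteq> []"
  shows "\<exists>L h ps. proj L \<and> h \<in> snd ` set L \<and>
    merges w = (merges L * hole_swaps h ps :: ('n, 'a::monoid_mult) wmon)"
  using assms(2,1)
proof (induction w rule: rev_nonempty_induct)
  case (single a)
  obtain i j where a: "a = (i, j)" by fastforce
  show ?case using single a
    by (intro exI[of _ "[a]"] exI[of _ j] exI[of _ "[]"]) (auto simp: proj_def proper_def)
next
  case (snoc a w)
  obtain i j where a: "a = (i, j)" by fastforce
  have ij: "i \<noteq> j" using snoc.prems a by (auto simp: proper_def)
  obtain L h ps where L: "proj L" "h \<in> snd ` set L"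
    "merges w = (merges L * hole_swaps h ps :: ('n, 'a::monoid_mult) wmon)"
    using snoc by (auto simp: proper_def)
  obtain p q where pq: "p \<noteq> q"
    "merges L * hole_swaps h ps * gen1 i j = (merges L * gen1 p q * hole_swaps q ps :: ('n, 'a) wmon)"
    using hole_swaps_gen1_inv[OF proj_hole[OF L(1,2)] ij] by metis
  have w: "merges (w @ [a]) = (merges L * gen1 p q * hole_swaps q ps :: ('n, 'a) wmon)"
    using pq L a by simp
  consider "q \<in> snd ` set L" | "q \<notin> snd ` set L" "p \<in> snd ` set L"
    | "q \<notin> snd ` set L" "p \<notin> snd ` set L" by blast
  then show ?case
  proof cases
    case 1
    then show ?thesis using w holeD[OF proj_hole[OF L(1) 1] pq(1)] L by metis
  next
    case 2
    have "hole_swaps p ((p, q) # ps) = (gen1 p q * hole_swaps q ps :: ('n, 'a) wmon)"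
      using pq by (simp add: hole_swap_def)
    then show ?thesis using w L 2 mult.assoc by metis
  next
    case 3
    let ?m = "\<lambda>(i, j). (if i = q then p else i, j)"
    have "merges L * gen1 p q = gen1 p q * (merges (map ?m L) :: ('n, 'a) wmon)"
    proof (rule merges_merge)
      fix i j assume ij: "(i, j) \<in> set L"
      then have "j \<in> snd ` set L" by (metis image_eqI snd_conv)
      then show "i \<noteq> j \<and> j \<noteq> p \<and> j \<noteq> q" using projD[OF L(1) ij] 3 by auto
    qed (rule pq)
    then have "merges (w @ [a]) = (merges ((p, q) # map ?m L) * hole_swaps q ps :: ('n, 'a) wmon)"
      using w by simp
    moreover have "proj ((p, q) # map ?m L)"
    proof -
      have m: "map snd (map ?m L) = map snd L" by (induction L) auto
      then have s: "snd ` set (map ?m L) = snd ` set L" by (metis set_map)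
      have "fst ` set (map ?m L) \<subseteq> insert p (fst ` set L - {q})"
        by (force split: if_splits)
      moreover have "fst ` set L \<inter> snd ` set L = {}" "distinct (map snd L)"
        using L(1) by (simp_all add: proj_def)
      ultimately have "insert p (fst ` set (map ?m L)) \<inter> insert q (snd ` set L) = {}"
        using 3 pq(1) by blast
      then have "fst ` set ((p, q) # map ?m L) \<inter> snd ` set ((p, q) # map ?m L) = {}"
        by (simp only: list.set image_insert s fst_conv snd_conv)
      moreover have "distinct (map snd ((p, q) # map ?m L))"
        using 3(1) \<open>distinct (map snd L)\<close> by (simp only: list.map m) simp
      ultimately show ?thesis by (simp only: proj_def)
    qed
    moreover have "q \<in> snd ` set ((p, q) # map ?m L)" by simp
    ultimately show ?thesis by blast
  qed
qed

lemma merges_left_absorb: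
  assumes "proper w" "w \<noteq> []" "i \<noteq> j"
    "to_map (merges w :: ('n, 'a::monoid_mult) wmon) i = to_map (merges w :: ('n, 'a) wmon) j"
  shows "gen1 i j * merges w = (merges w :: ('n, 'a::monoid_mult) wmon)"
proof -
  obtain L h ps where L: "proj L" "h \<in> snd ` set L"
    "merges w = (merges L * hole_swaps h ps :: ('n, 'a::monoid_mult) wmon)"
    using merges_normal_form[OF assms(1,2)] by blast
  have *: "to_map (merges w :: ('n, 'a) wmon) x = perm ps (to_map (merges L :: ('n, 'a) wmon) x)" for x
    using to_map_hole_swaps[of "to_map (merges L :: ('n, 'a) wmon) x" h ps] L(2,3) to_map_merges_notin[OF L(1), of x]
    by (metis comp_apply to_map_simps(2))
  have "to_map (merges L :: ('n, 'a) wmon) i = to_map (merges L :: ('n, 'a) wmon) j"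
    using assms(4) by (simp add: * inj_eq[OF bij_is_inj[OF bij_perm]])
  from proj_left_absorb[OF L(1) this assms(3)] show ?thesis
    using L(3) by (simp add: mult.assoc[symmetric])
qed

text \<open>The case distinction of \<open>merges_normal_form\<close> with \<open>L\<close> fixed: a
  genuine merge would identify two points that \<open>u\<close> keeps apart, so only absorbed
  letters and moves occur. The kernel condition passes to prefixes of \<open>w\<close>.\<close>

lemma merges_same_kernel:
  fixes L w defines "u \<equiv> merges L :: ('n, 'a::monoid_mult) wmon"
  assumes "proj L" "L \<noteq> []" "proper w"
    "\<And>i j. to_map (u * merges w) i = to_map (u * merges w) j \<Longrightarrow> to_map u i = to_map u j"
  shows "\<exists>h ps. h \<in> snd ` set L \<and> u * merges w = u * hole_swaps h ps"
  using assms(4,5)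
proof (induction w rule: rev_induct)
  case Nil
  show ?case using assms(3) by (intro exI[of _ "snd (hd L)"] exI[of _ "[]"]) auto
next
  case (snoc a w)
  obtain i j where a: "a = (i, j)" by fastforce
  have ij: "i \<noteq> j" using snoc.prems a by (auto simp: proper_def)
  have "\<exists>h ps. h \<in> snd ` set L \<and> u * merges w = u * hole_swaps h ps"
    using snoc.prems by (intro snoc.IH) (auto simp: proper_def)
  then obtain h ps where h: "h \<in> snd ` set L" "u * merges w = u * hole_swaps h ps" by blast
  have hole: "hole k u" if "k \<in> snd ` set L" for k
    using proj_hole[OF assms(2) that] by (simp add: u_def)
  obtain p q where pq: "p \<noteq> q" "u * hole_swaps h ps * gen1 i j = u * gen1 p q * hole_swaps q ps"
    using hole_swaps_gen1_inv[OF hole[OF h(1)] ij] by metis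
  have w: "u * merges (w @ [a]) = u * gen1 p q * hole_swaps q ps"
    using pq h a by (simp add: mult.assoc[symmetric])
  consider "q \<in> snd ` set L" | "p \<in> snd ` set L"
    | "q \<notin> snd ` set L" "p \<notin> snd ` set L" by blast
  then show ?case
  proof cases
    case 1
    then show ?thesis using w holeD[OF hole[OF 1] pq(1)] by metis
  next
    case 2
    have "hole_swaps p ((p, q) # ps) = (gen1 p q * hole_swaps q ps :: ('n, 'a) wmon)"
      using pq by (simp add: hole_swap_def)
    then show ?thesis using w 2 mult.assoc by metis
  next
    case 3
    then have u: "to_map u p = p" "to_map u q = q" by (auto simp: u_def to_map_merges_id)
    have "to_map (u * merges (w @ [a])) p = to_map (u * merges (w @ [a])) q"
      unfolding w by (simp add: u eps_def)
    then show ?thesis using snoc.prems(2) u pq by metis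
  qed
qed

text \<open>The first word is a projection \<open>merges L\<close> followed by a permutation. Every
  letter of \<open>L\<close> lies in the common kernel, so the second word absorbs
  \<open>merges L\<close> on its left and is, by \<open>merges_same_kernel\<close>, the same
  projection followed by a permutation. The two permutations agree off the holes.\<close>

lemma merges_complete:
  fixes w w' :: "('n::finite \<times> 'n) list"
  assumes "proper w" "w \<noteq> []" "proper w'" "w' \<noteq> []"
    "to_map (merges w :: ('n, 'a::monoid_mult) wmon) = to_map (merges w' :: ('n, 'a) wmon)"
  shows "merges w = (merges w' :: ('n, 'a::monoid_mult) wmon)"
proof -
  obtain L h ps where L: "proj L" "h \<in> snd ` set L"
    "merges w = (merges L * hole_swaps h ps :: ('n, 'a::monoid_mult) wmon)"
    using merges_normal_form[OF assms(1,2)] by blast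
  let ?u = "merges L :: ('n, 'a::monoid_mult) wmon"
  have m: "to_map (?u * hole_swaps h ps) x = perm ps (to_map ?u x)" if "h \<in> snd ` set L" for x h ps
    using to_map_hole_swaps[of "to_map ?u x" h ps] to_map_merges_notin[OF L(1), of x] that
    by (metis comp_apply to_map_simps(2))
  have e: "to_map (merges w' :: ('n, 'a) wmon) x = perm ps (to_map ?u x)" for x
    using m[OF L(2), of ps x] by (simp add: assms(5)[symmetric] L(3))
  have ker: "to_map ?u i = to_map ?u j"
    if "to_map (merges w' :: ('n, 'a) wmon) i = to_map (merges w' :: ('n, 'a) wmon) j" for i j
    using that by (simp add: e inj_eq[OF bij_is_inj[OF bij_perm]])
  have "merges L' * merges w' = (merges w' :: ('n, 'a::monoid_mult) wmon)" if "set L' \<subseteq> set L" for L'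
    using that
  proof (induction L')
    case (Cons a L')
    obtain i j where a: "a = (i, j)" by fastforce
    then have ij: "(i, j) \<in> set L" using Cons.prems by auto
    then have i: "i \<notin> snd ` set L" and "i \<noteq> j"
      using projD[OF L(1)] by auto
    have "to_map ?u i = to_map ?u j"
      using to_map_merges_proj[OF L(1) ij, where 'a = 'a] to_map_merges_id[OF i, where 'a = 'a] by simp
    then have "to_map (merges w' :: ('n, 'a) wmon) i = to_map (merges w' :: ('n, 'a) wmon) j"
      unfolding e by simp
    then show ?case
      using merges_left_absorb[where 'a = 'a, OF assms(3,4) \<open>i \<noteq> j\<close>] Cons a by (simp add: mult.assoc)
  qed simp
  then have u: "?u * merges w' = merges w'" by simp
  have "\<exists>h ps. h \<in> snd ` set L \<and> ?u * merges w' = ?u * hole_swaps h ps"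
  proof (rule merges_same_kernel[OF L(1) _ assms(3)])
    show "L \<noteq> []" using L(2) by auto
    fix i j assume "to_map (?u * merges w') i = to_map (?u * merges w') j"
    then have "to_map (merges w' :: ('n, 'a) wmon) i = to_map (merges w' :: ('n, 'a) wmon) j"
      unfolding u .
    then show "to_map ?u i = to_map ?u j" by (rule ker)
  qed
  then obtain h' ps' where h': "h' \<in> snd ` set L" "?u * merges w' = ?u * hole_swaps h' ps'" by blast
  have "?u * hole_swaps h ps = ?u * hole_swaps h' ps'"
  proof (rule hole_swaps_eq_off_holes[where H = "snd ` set L"])
    show "hole j ?u" if "j \<in> snd ` set L" for j using L(1) that by (rule proj_hole)
    fix k assume "k \<notin> snd ` set L"
    then have "to_map ?u k = k" by (rule to_map_merges_id)
    then show "perm ps k = perm ps' k"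
      using e[of k] m[OF h'(1), of ps' k] h'(2) u by metis
  qed (rule L(2) h'(1))+
  then show ?thesis using L h' u by simp
qed

section \<open>Labels\<close>

text \<open>Once \<open>h\<close> is a hole, the letter \<open>gen k h c 1\<close> is a pure change
  of label at \<open>k\<close>, because its merge finds nothing at \<open>h\<close>.\<close>

definition labels :: "'n \<Rightarrow> ('n \<times> 'a) list \<Rightarrow> ('n, 'a::monoid_mult) wmon" where
  "labels h L = prod_list (map (\<lambda>(k, c). gen k h c 1) L)"

lemma labels_simps [simp]:
  "labels h [] = 1"
  "labels h ((k, c) # L) = gen k h c 1 * labels h L"
  "labels h (L @ L') = labels h L * labels h L'"
  by (simp_all add: labels_def)

lemma hole_labels:
  assumes "hole h u" "h \<notin> fst ` set L"
  shows "hole h (u * labels h L)"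
  using assms
proof (induction L arbitrary: u)
  case (Cons a L)
  obtain k c where a: "a = (k, c)" by fastforce
  have "hole h (u * gen k h c 1)" using Cons.prems a by (intro hole_gen) auto
  then have "hole h (u * gen k h c 1 * labels h L)" using Cons.prems by (intro Cons.IH) auto
  then show ?case using a by (simp add: mult.assoc)
qed simp

text \<open>\<open>gen_shift\<close> needs equal labels in its first letter; the label at the hole
  \<open>h\<close> is invisible and may be set to \<open>a\<close>.\<close>

lemma label_commute:
  assumes "hole h u" "distinct [h, i, j]"
  shows "u * gen i h a 1 * gen j h b 1 = u * gen j h b 1 * gen i h a 1"
proof -
  have "u * gen i h a 1 * gen j h b 1 = u * (gen i h a a * gen j h b 1)"
    using hole_second_label[OF assms(1), of i a 1 a] assms(2) by (auto simp: mult.assoc[symmetric])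
  also have "\<dots> = u * gen1 i h * gen j h b 1 * gen i h a 1"
    using gen_shift[of i j h a b] assms(2) by (auto simp: mult.assoc)
  also have "u * gen1 i h = u" using assms by (intro holeD) auto
  finally show ?thesis .
qed

lemma label_labels_commute:
  assumes "hole h u" "h \<notin> fst ` set L" "k \<notin> fst ` set L" "k \<noteq> h"
  shows "u * labels h L * gen k h c 1 = u * gen k h c 1 * labels h L"
  using assms(1-3)
proof (induction L arbitrary: u)
  case (Cons a L)
  obtain m d where a: "a = (m, d)" by fastforce
  have hole: "hole h (u * gen m h d 1)" using Cons.prems a by (intro hole_gen) auto
  have "u * labels h (a # L) * gen k h c 1 = u * gen m h d 1 * labels h L * gen k h c 1"
    using a by (simp add: mult.assoc)
  also have "\<dots> = u * gen m h d 1 * gen k h c 1 * labels h L"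
    using Cons.prems by (intro Cons.IH hole) auto
  also have "u * gen m h d 1 * gen k h c 1 = u * gen k h c 1 * gen m h d 1"
    using Cons.prems a assms(4) by (intro label_commute) auto
  finally show ?case using a by (simp add: mult.assoc)
qed simp

text \<open>An inserted \<open>gen1 i h\<close> lets the first fan relation split off the label at
  \<open>i\<close>; inserted again, it lets the second one split off the label at
  \<open>j\<close>.\<close>

lemma gen_two_labels:
  assumes "hole h u" "distinct [h, i, j]"
  shows "u * gen i j a b = u * gen i h a 1 * gen j h b 1 * gen1 i j"
proof -
  have hole: "hole h (u * gen i j a b)" "hole h (u * gen i h a 1)"
    using assms by (auto intro: hole_persists)
  have "u * gen i j a b = u * gen i j a b * gen1 i h" using holeD[OF hole(1), of i 1] assms by auto
  also have "\<dots> = u * gen i h a 1 * gen i j 1 b"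
    using gen_fan1[of i j h a b 1 1] assms by (auto simp: mult.assoc)
  also have "\<dots> = u * gen i h a 1 * gen1 i h * gen i j 1 b"
    using holeD[OF hole(2), of i 1] assms by auto
  also have "\<dots> = u * gen i h a 1 * gen j h b 1 * gen1 i j"
    using gen_fan2[of i j h 1 1 1 b] assms by (auto simp: mult.assoc)
  finally show ?thesis .
qed

lemma gen_labels:
  assumes "hole h u" "i \<noteq> j"
  shows "\<exists>L. h \<notin> fst ` set L \<and> u * gen i j a b = u * labels h L * gen1 i j"
proof -
  consider "j = h" | "i = h" | "distinct [h, i, j]" using assms by auto
  then show ?thesis
  proof cases
    case 1
    have "u * gen i h a b = u * gen i h a 1" by (rule hole_second_label) (use assms 1 in auto)
    also have "\<dots> = u * (gen i h a 1 * gen1 i h)" using assms 1 by (simp add: gen_mult)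
    finally show ?thesis
      using 1 assms by (intro exI[of _ "[(i, a)]"]) (simp add: mult.assoc)
  next
    case 2
    have "u * gen h j a b = u * (gen j h b a * gen1 h j)"
      using assms 2 by (simp add: gen_mult_swap)
    also have "\<dots> = u * gen j h b 1 * gen1 h j"
      using hole_second_label[OF assms(1), of j b a 1] assms 2 by (simp add: mult.assoc[symmetric])
    finally show ?thesis
      using 2 assms by (intro exI[of _ "[(j, b)]"]) simp
  next
    case 3
    show ?thesis using gen_two_labels[OF assms(1) 3, of a b] 3
      by (intro exI[of _ "[(i, a), (j, b)]"]) (auto simp: mult.assoc)
  qed
qed

lemma two_holes_label:
  assumes "hole h u" "hole h' u" "k \<noteq> h" "k \<noteq> h'"
  shows "u * gen k h c 1 = u * gen k h' c 1"
proof (cases "h = h'")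
  case False
  have hole: "hole h (u * gen k h' c 1)" "hole h' (u * gen k h c 1)"
    using assms by (auto intro: hole_persists)
  have "u * gen k h' c 1 = u * gen k h' c 1 * gen1 k h" using holeD[OF hole(1), of k 1] assms by auto
  also have "\<dots> = u * gen k h c 1 * gen1 k h'"
    using gen_fan1[of k h' h c 1 1 1] assms False by (auto simp: mult.assoc)
  also have "\<dots> = u * gen k h c 1" using holeD[OF hole(2), of k 1] assms by auto
  finally show ?thesis ..
qed simp

lemma two_holes_labels:
  assumes "hole h u" "hole h' u" "h \<notin> fst ` set L" "h' \<notin> fst ` set L"
  shows "u * labels h L = u * labels h' L"
  using assms
proof (induction L arbitrary: u)
  case (Cons a L)
  obtain k c where a: "a = (k, c)" by fastforce
  have "u * gen k h c 1 = u * gen k h' c 1" using Cons.prems a by (intro two_holes_label) auto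
  moreover have "u * gen k h c 1 * labels h L = u * gen k h c 1 * labels h' L"
    using Cons.prems a by (intro Cons.IH hole_persists) auto
  ultimately show ?case using a by (simp add: mult.assoc[symmetric])
qed simp

text \<open>The label falls on an empty position: after inserting \<open>gen1 h' h\<close>,
  \<open>gen_mult_swap\<close> erases it and leaves \<open>gen1 h h'\<close>.\<close>

lemma two_holes_label_hole:
  assumes "hole h u" "hole h' u" "h \<noteq> h'"
  shows "u * gen h h' c 1 = u"
proof -
  have "u * gen h h' c 1 = u * gen1 h' h * gen h h' c 1" using holeD[OF assms(1), of h' 1] assms by auto
  also have "\<dots> = u * gen1 h h'" using assms by (simp add: mult.assoc gen_mult_swap)
  also have "\<dots> = u" using holeD[OF assms(2)] assms by auto
  finally show ?thesis .
qed

lemma move_label: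
  assumes "hole h u" "distinct [h, j, k]"
  shows "u * gen1 h j * gen k j c 1 = u * gen k h c 1 * gen1 h j"
proof -
  have "u * gen1 h j * gen k j c 1 = u * gen1 j h * gen k h c 1 * gen1 h j"
    using gen_rotate[of h k j 1 1 c] assms by (auto simp: mult.assoc)
  also have "u * gen1 j h = u" using holeD[OF assms(1)] assms by auto
  finally show ?thesis .
qed

text \<open>A label at \<open>k\<close> after the merge belongs to the tokens that the merge brings
  to \<open>k\<close>: those of \<open>i\<close> and \<open>j\<close> if \<open>k = i\<close>, none
  if \<open>k\<close> is the hole \<open>h\<close> and differs from \<open>i\<close>, and that of
  \<open>k\<close> otherwise.\<close>

lemma label_push:
  assumes "hole h u" "i \<noteq> j" "k \<noteq> j"
  shows "\<exists>L. h \<notin> fst ` set L \<and> u * gen1 i j * gen k j c 1 = u * labels h L * gen1 i j"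
proof -
  consider "k = i" | "k \<noteq> i" "j = h" | "k \<noteq> i" "i = h" | "distinct [i, j, k]" "i \<noteq> h" "k = h"
    | "distinct [h, i, j, k]"
    using assms by auto
  then show ?thesis
  proof cases
    case 1
    then have "u * gen1 i j * gen k j c 1 = u * gen i j c c"
      using assms by (simp add: mult.assoc gen_mult)
    then show ?thesis using gen_labels[OF assms(1,2), of c c] by simp
  next
    case 2
    have "hole h (u * gen k h c 1)" using assms 2 by (intro hole_gen) auto
    then have "u * gen k h c 1 * gen1 i h = u * gen k h c 1" using holeD assms 2 by metis
    moreover have "u * gen1 i h = u" using holeD[OF assms(1)] assms 2 by auto
    ultimately show ?thesis using assms 2 by (intro exI[of _ "[(k, c)]"]) simp
  next
    case 3
    have "u * gen1 h j * gen k j c 1 = u * gen k h c 1 * gen1 h j"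
      using assms 3 by (intro move_label) auto
    then show ?thesis using assms 3 by (intro exI[of _ "[(k, c)]"]) simp
  next
    case 4
    have "u * gen1 i j * gen h j c 1 = u * gen1 i j"
      using assms 4 by (intro two_holes_label_hole hole_persists hole_gen) auto
    then show ?thesis using 4 by (intro exI[of _ "[]"]) simp
  next
    case 5
    have "u * gen1 i j * gen k j c 1 = u * gen1 i j * gen k h c 1"
      using assms 5 by (intro two_holes_label hole_persists hole_gen) auto
    also have "\<dots> = u * gen k h c 1 * gen1 i j"
      using gen_commute[of i j k h 1 1 c 1] 5 by (auto simp: mult.assoc)
    finally show ?thesis using 5 by (intro exI[of _ "[(k, c)]"]) simp
  qed
qed

lemma labels_push:
  assumes "hole h u" "i \<noteq> j" "j \<notin> fst ` set L"
  shows "\<exists>L'. h \<notin> fst ` set L' \<and> u * gen1 i j * labels j L = u * labels h L' * gen1 i j"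
  using assms(1,3)
proof (induction L arbitrary: u)
  case Nil
  show ?case by (intro exI[of _ "[]"]) simp
next
  case (Cons a L)
  obtain k c where a: "a = (k, c)" by fastforce
  have "k \<noteq> j" using Cons.prems a by auto
  obtain L1 where L1: "h \<notin> fst ` set L1"
    "u * gen1 i j * gen k j c 1 = u * labels h L1 * gen1 i j"
    using label_push[OF Cons.prems(1) assms(2) \<open>k \<noteq> j\<close>] by metis
  have "\<exists>L'. h \<notin> fst ` set L' \<and>
      u * labels h L1 * gen1 i j * labels j L = u * labels h L1 * labels h L' * gen1 i j"
    using Cons.prems L1 by (intro Cons.IH hole_labels) auto
  then obtain L2 where L2: "h \<notin> fst ` set L2"
    "u * labels h L1 * gen1 i j * labels j L = u * labels h L1 * labels h L2 * gen1 i j" by blast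
  have "u * gen1 i j * labels j (a # L) = u * gen1 i j * gen k j c 1 * labels j L"
    using a by (simp add: mult.assoc)
  also have "\<dots> = u * labels h (L1 @ L2) * gen1 i j"
    unfolding L1(2) L2(2) by (simp add: mult.assoc)
  finally show ?case using L1 L2 by (intro exI[of _ "L1 @ L2"]) auto
qed

section \<open>Collecting the labels at the front\<close>

definition to_wmon :: "('n, 'a::monoid_mult) letter list \<Rightarrow> ('n, 'a) wmon" where
  "to_wmon w = prod_list (map (\<lambda>x. case x of E i j a b \<Rightarrow> gen i j a b) w)"

lemma to_wmon_simps [simp]:
  "to_wmon [] = 1"
  "to_wmon (E i j a b # w) = gen i j a b * to_wmon w"
  "to_wmon (v @ w) = to_wmon v * to_wmon w"
  by (simp_all add: to_wmon_def)

lemma to_wmon_eq_abs: "to_wmon w = abs_wmon w"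
proof (induction w)
  case Nil
  show ?case by (simp add: one_wmon.abs_eq)
next
  case (Cons x w)
  then show ?case
    by (cases x) (simp add: gen.abs_eq times_wmon.abs_eq)
qed

lemma to_wmon_eq_iff: "to_wmon u = to_wmon v \<longleftrightarrow> eqv u v"
  by (simp add: to_wmon_eq_abs wmon.abs_eq_iff)

lemma val_to_wmon: "val (to_wmon w) = word_val w"
  by (simp add: to_wmon_eq_abs val.abs_eq)

text \<open>The first letter keeps its own labels, as no hole precedes it, and creates the hole
  \<open>j\<close>; all labels of the remaining word are pushed left and written through this
  hole.\<close>

lemma to_wmon_labels_first:
  assumes "w \<noteq> []" "set w \<subseteq> X2"
  shows "\<exists>i j a b L v. i \<noteq> j \<and> j \<notin> fst ` set L \<and> proper v \<and>
    to_wmon w = gen i j a b * labels j L * merges v"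
  using assms
proof (induction w rule: list_nonempty_induct)
  case (single x)
  then obtain i j a b where "x = E i j a b" "i \<noteq> j" by (auto simp: X2_def)
  then show ?case
    by (intro exI[of _ i] exI[of _ j] exI[of _ a] exI[of _ b] exI[of _ "[]"])
      (simp add: proper_def)
next
  case (cons x w)
  then obtain i j a b where x: "x = E i j a b" "i \<noteq> j" by (auto simp: X2_def)
  obtain k l c d L v where IH: "k \<noteq> l" "l \<notin> fst ` set L" "proper v"
    "to_wmon w = gen k l c d * labels l L * merges v"
    using cons by auto
  let ?u = "gen i j a b"
  have hole: "hole j ?u" using hole_gen[OF x(2), of 1] by simp
  obtain L1 where L1: "j \<notin> fst ` set L1" "?u * gen k l c d = ?u * labels j L1 * gen1 k l"
    using gen_labels[OF hole IH(1)] by metis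
  obtain L2 where L2: "j \<notin> fst ` set L2"
    "?u * labels j L1 * gen1 k l * labels l L = ?u * labels j L1 * labels j L2 * gen1 k l"
    using labels_push[OF hole_labels[OF hole L1(1)] IH(1,2)] by metis
  have "to_wmon (x # w) = ?u * gen k l c d * labels l L * merges v" using x IH by (simp add: mult.assoc)
  also have "\<dots> = ?u * labels j (L1 @ L2) * merges ((k, l) # v)"
    unfolding L1(2) L2(2) by (simp add: mult.assoc)
  finally show ?case
    using x(2) L1(1) L2(1) IH(1,3)
    by (intro exI[of _ i] exI[of _ j] exI[of _ a] exI[of _ b] exI[of _ "L1 @ L2"]
        exI[of _ "(k, l) # v"]) (auto simp: proper_def)
qed

text \<open>Under \<open>enum_except i j ks\<close> this represents the element (\<open>a\<close>,
  \<open>eps i j\<close>) of the wreath product.\<close>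

definition labelled :: "'n \<Rightarrow> 'n \<Rightarrow> ('n \<Rightarrow> 'a) \<Rightarrow> 'n list \<Rightarrow> ('n, 'a::monoid_mult) wmon" where
  "labelled i j a ks = gen i j (a i) (a j) * labels j (map (\<lambda>k. (k, a k)) ks)"

definition enum_except :: "'n \<Rightarrow> 'n \<Rightarrow> 'n list \<Rightarrow> bool" where
  "enum_except i j ks \<longleftrightarrow> distinct ks \<and> set ks = UNIV - {i, j}"

lemma hole_gen_one: "i \<noteq> j \<Longrightarrow> hole j (gen i j a b)"
  using hole_gen[of i j 1] by simp

lemma labels_one:
  assumes "hole h u" "h \<notin> set ks"
  shows "u * labels h (map (\<lambda>k. (k, 1)) ks) = u"
  using assms(2)
proof (induction ks)
  case (Cons k ks)
  then have "u * gen1 k h = u" using holeD[OF assms(1)] by auto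
  then show ?case using Cons by (simp add: mult.assoc[symmetric])
qed simp

lemma labels_normal:
  assumes "i \<noteq> j" "j \<notin> fst ` set L" "enum_except i j ks"
  shows "\<exists>c. gen i j a b * labels j L = labelled i j c ks"
  using assms(2)
proof (induction L rule: rev_induct)
  case Nil
  define c where "c = (\<lambda>k. if k = i then a else if k = j then b else 1)"
  have m: "map (\<lambda>k. (k, c k)) ks = map (\<lambda>k. (k, 1)) ks" "c i = a" "c j = b"
    using assms(1,3) by (auto simp: c_def enum_except_def)
  have "labelled i j c ks = gen i j a b"
    unfolding labelled_def m using labels_one[OF hole_gen_one[OF assms(1)], of ks a b] assms(3)
    by (simp add: enum_except_def)
  then show ?case by (metis labels_simps(1) mult.right_neutral)
next
  case (snoc x L)
  obtain k d where x: "x = (k, d)" by fastforce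
  have kj: "k \<noteq> j" using snoc.prems x by auto
  obtain c where c: "gen i j a b * labels j L = labelled i j c ks" using snoc by auto
  have eq: "gen i j a b * labels j (L @ [x]) = labelled i j c ks * gen k j d 1"
    using c x by (simp add: mult.assoc[symmetric])
  let ?m = "\<lambda>c ks. map (\<lambda>k. (k, c k)) ks"
  have ks: "distinct ks" "j \<notin> set ks" "i \<notin> set ks" using assms(3) by (auto simp: enum_except_def)
  show ?case
  proof (cases "k = i")
    case True
    \<comment> \<open>As \<open>j\<close> has been merged into \<open>i\<close>, a later label at
      \<open>i\<close> multiplies both entries.\<close>
    let ?c = "c(i := c i * d, j := c j * d)"
    have m: "?m ?c ks = ?m c ks" using ks by auto
    have "labelled i j c ks * gen i j d 1 = gen i j (c i) (c j) * gen i j d 1 * labels j (?m c ks)"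
      unfolding labelled_def using ks assms(1)
      by (intro label_labels_commute hole_gen_one) (auto simp: image_image)
    also have "\<dots> = labelled i j ?c ks"
      unfolding labelled_def m using assms(1) by (simp add: gen_mult)
    finally show ?thesis using eq True by metis
  next
    case False
    then have "k \<in> set ks" using assms(3) kj by (auto simp: enum_except_def)
    then obtain ys zs where sp: "ks = ys @ k # zs" by (meson split_list)
    let ?c = "c(k := c k * d)"
    have m: "?m ?c ys = ?m c ys" "?m ?c zs = ?m c zs" using ks sp by auto
    let ?u = "gen i j (c i) (c j) * labels j (?m c ys)"
    have u: "hole j ?u"
      using assms(1) ks sp by (intro hole_labels hole_gen_one) (auto simp: image_image)
    have "labelled i j c ks * gen k j d 1 = ?u * gen k j (c k) 1 * labels j (?m c zs) * gen k j d 1"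
      unfolding labelled_def sp by (simp add: mult.assoc)
    also have "\<dots> = ?u * gen k j (c k) 1 * gen k j d 1 * labels j (?m c zs)"
      using ks sp kj
      by (intro label_labels_commute hole_gen) (auto simp: image_image)
    \<comment> \<open>\<open>gen_mult\<close> leaves the label \<open>d\<close> at the hole
      \<open>j\<close>; it is reset to 1.\<close>
    also have "\<dots> = ?u * gen k j (c k * d) 1 * labels j (?m c zs)"
      using hole_second_label[OF u kj, of "c k * d" d 1] kj
      by (simp add: mult.assoc gen_mult)
    also have "\<dots> = labelled i j ?c ks"
      unfolding labelled_def sp map_append list.map m labels_simps
      using False kj by (simp add: mult.assoc)
    finally show ?thesis using eq by metis
  qed
qed

lemma labels_perm:
  assumes "hole h u" "distinct ks" "distinct ls" "set ks = set ls" "h \<notin> set ks"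
  shows "u * labels h (map (\<lambda>k. (k, a k)) ks) = u * labels h (map (\<lambda>k. (k, a k)) ls)"
  using assms
proof (induction ks arbitrary: u ls)
  case (Cons k ks)
  let ?m = "map (\<lambda>k. (k, a k))"
  obtain ys zs where sp: "ls = ys @ k # zs" using Cons.prems by (metis list.set_intros(1) split_list)
  have kh: "k \<noteq> h" using Cons.prems by auto
  have "u * labels h (?m ls) = u * labels h (?m ys) * gen k h (a k) 1 * labels h (?m zs)"
    using sp by (simp add: mult.assoc)
  also have "u * labels h (?m ys) * gen k h (a k) 1 = u * gen k h (a k) 1 * labels h (?m ys)"
    using Cons.prems sp kh
    by (intro label_labels_commute) (auto simp: image_image)
  also have "\<dots> * labels h (?m zs) = u * gen k h (a k) 1 * labels h (?m (ys @ zs))"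
    by (simp add: mult.assoc)
  also have "\<dots> = u * gen k h (a k) 1 * labels h (?m ks)"
    using Cons.prems sp kh by (intro Cons.IH[symmetric] hole_gen) auto
  finally show ?case by (simp add: mult.assoc)
qed simp

lemma labelled_perm:
  assumes "i \<noteq> j" "enum_except i j ks" "enum_except i j ls"
  shows "labelled i j a ks = labelled i j a ls"
  unfolding labelled_def using assms by (intro labels_perm hole_gen_one) (auto simp: enum_except_def)

text \<open>The letter \<open>gen1 i j\<close> travels left past the labels by
  \<open>move_label\<close>, switching them from hole \<open>i\<close> to hole \<open>j\<close>, and
  then combines with the first letter.\<close>

lemma labelled_flip:
  assumes "i \<noteq> j" "enum_except i j ks"
  shows "labelled j i a ks * gen1 i j = labelled i j a ks"
proof -
  have "u * labels i (map (\<lambda>k. (k, a k)) ks) * gen1 i j = u * gen1 i j * labels j (map (\<lambda>k. (k, a k)) ks)"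
    if "hole i u" "i \<notin> set ks" "j \<notin> set ks" for u and ks
    using that
  proof (induction ks arbitrary: u)
    case (Cons k ks)
    let ?m = "map (\<lambda>k. (k, a k))"
    have "u * labels i (?m (k # ks)) * gen1 i j = u * gen k i (a k) 1 * labels i (?m ks) * gen1 i j"
      by (simp add: mult.assoc)
    also have "\<dots> = u * gen k i (a k) 1 * gen1 i j * labels j (?m ks)"
      using Cons.prems by (intro Cons.IH hole_gen) auto
    also have "u * gen k i (a k) 1 * gen1 i j = u * gen1 i j * gen k j (a k) 1"
      using Cons.prems assms(1) by (intro move_label[symmetric]) auto
    finally show ?case by (simp add: mult.assoc)
  qed simp
  from this[OF hole_gen_one] have "labelled j i a ks * gen1 i j
      = gen j i (a j) (a i) * gen1 i j * labels j (map (\<lambda>k. (k, a k)) ks)"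
    unfolding labelled_def using assms by (auto simp: enum_except_def)
  also have "\<dots> = labelled i j a ks"
    unfolding labelled_def using assms by (simp add: gen_mult_swap)
  finally show ?thesis .
qed

lemma labels_gen1_commute:
  assumes "k \<noteq> l" "j \<noteq> k" "j \<noteq> l" "set ks \<inter> {j, k, l} = {}"
  shows "labels j (map (\<lambda>m. (m, a m)) ks) * gen1 k l = gen1 k l * labels j (map (\<lambda>m. (m, a m)) ks)"
  using assms(4)
proof (induction ks)
  case (Cons m ks)
  then have "gen m j (a m) 1 * gen1 k l = gen1 k l * gen m j (a m) 1"
    using assms by (intro gen_commute) auto
  then show ?case using Cons by (simp add: mult.assoc) (simp add: mult.assoc[symmetric])
qed simp

text \<open>The label of \<open>k\<close>, written through \<open>j\<close>, is put back into a
  letter \<open>gen i k\<close>. In this form \<open>gen_fan1\<close> exchanges the first two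
  letters, which lets \<open>j\<close> and \<open>k\<close> trade roles.\<close>

lemma labelled_fan:
  assumes "distinct [i, j, k]" "j \<notin> set ks" "i \<notin> set ks" "k \<notin> set ks"
  shows "labelled i j a (k # ks) * gen1 i k
    = gen i j (a i) (a j) * gen i k 1 (a k) * labels j (map (\<lambda>m. (m, a m)) ks)"
proof -
  let ?u = "gen i j (a i) (a j)" and ?l = "labels j (map (\<lambda>m. (m, a m)) ks)"
  have u: "hole j ?u" using assms by (intro hole_gen_one) auto
  have "labelled i j a (k # ks) * gen1 i k = ?u * gen k j (a k) 1 * (?l * gen1 i k)"
    by (simp add: labelled_def mult.assoc)
  also have "?l * gen1 i k = gen1 i k * ?l"
    using assms by (intro labels_gen1_commute) auto
  also have "?u * gen k j (a k) 1 * (gen1 i k * ?l) = ?u * gen1 i j * gen k j (a k) 1 * gen1 i k * ?l"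
    using holeD[OF u, of i 1] assms by (simp add: mult.assoc[symmetric])
  also have "\<dots> = ?u * gen i k 1 (a k) * ?l"
    using gen_two_labels[OF u, of i k 1 "a k"] assms by auto
  finally show ?thesis .
qed

lemma labelled_disjoint:
  assumes "distinct [i, j, k, l]" "set ks \<inter> {i, j, k, l} = {}"
  shows "labelled i j a (k # l # ks) * gen1 k l
    = gen i j (a i) (a j) * gen k l (a k) (a l) * labels j (map (\<lambda>m. (m, a m)) ks)"
proof -
  let ?u = "gen i j (a i) (a j)" and ?l = "labels j (map (\<lambda>m. (m, a m)) ks)"
  have u: "hole j ?u" using assms by (intro hole_gen_one) auto
  have "labelled i j a (k # l # ks) * gen1 k l
      = ?u * gen k j (a k) 1 * gen l j (a l) 1 * (?l * gen1 k l)"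
    by (simp add: labelled_def mult.assoc)
  also have "?l * gen1 k l = gen1 k l * ?l"
    using assms by (intro labels_gen1_commute) auto
  also have "?u * gen k j (a k) 1 * gen l j (a l) 1 * (gen1 k l * ?l) = ?u * gen k l (a k) (a l) * ?l"
    using gen_two_labels[OF u, of k l "a k" "a l"] assms by (auto simp: mult.assoc[symmetric])
  finally show ?thesis .
qed

lemma enum_except_ex:
  fixes i j :: "'n::finite"
  shows "\<exists>ks. enum_except i j ks"
  using finite_distinct_list[of "UNIV - {i, j}"] by (auto simp: enum_except_def)

text \<open>\<open>merges v\<close> absorbs \<open>gen1\<close> on its left for every pair in its
  kernel, so such letters can be inserted after the labels. With them the carrying pair can be
  flipped, changed in its second index, or replaced by a disjoint pair; these changes link any two
  pairs.\<close>

lemma labelled_eq: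
  fixes i j k l :: "'n::finite" and v :: "('n \<times> 'n) list" and a :: "'n \<Rightarrow> 'a::monoid_mult"
  defines "\<alpha> \<equiv> to_map (merges v :: ('n, 'a) wmon)"
  assumes "proper v" "v \<noteq> []" "i \<noteq> j" "k \<noteq> l" "\<alpha> i = \<alpha> j" "\<alpha> k = \<alpha> l"
    "enum_except i j ks" "enum_except k l ls"
  shows "labelled i j a ks * merges v = labelled k l a ls * merges v"
proof -
  \<comment> \<open>By \<open>labelled_perm\<close> any enumeration gives the same value, so only
    the pair remains as a parameter.\<close>
  define F where "F i j = labelled i j a (SOME ks. enum_except i j ks) * merges v" for i j
  have F: "labelled i j a ks * merges v = F i j" if "i \<noteq> j" "enum_except i j ks" for i j ks
    unfolding F_def using labelled_perm[OF that(1)] someI_ex[OF enum_except_ex] that(2) by metis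
  have absorb: "gen1 i j * merges v = (merges v :: ('n, 'a) wmon)" if "i \<noteq> j" "\<alpha> i = \<alpha> j" for i j
    using merges_left_absorb[OF assms(2,3) that(1)] that(2) unfolding \<alpha>_def .
  have flip: "F i j = F j i" if "i \<noteq> j" "\<alpha> i = \<alpha> j" for i j
  proof -
    obtain ks where ks: "enum_except i j ks" using enum_except_ex by blast
    then have ks': "enum_except j i ks" by (auto simp: enum_except_def)
    have "F i j = labelled j i a ks * (gen1 i j * merges v)"
      using F[OF that(1) ks] labelled_flip[OF that(1) ks, of a] by (simp add: mult.assoc[symmetric])
    also have "\<dots> = F j i" using absorb[OF that] F[OF that(1)[symmetric] ks'] by simp
    finally show ?thesis .
  qed
  have fan: "F i j = F i k" if "distinct [i, j, k]" "\<alpha> i = \<alpha> j" "\<alpha> i = \<alpha> k" for i j k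
  proof -
    obtain ks where ks: "distinct ks" "set ks = UNIV - {i, j, k}"
      using finite_distinct_list[of "UNIV - {i, j, k}"] by auto
    let ?l = "\<lambda>j. labels j (map (\<lambda>m. (m, a m)) ks)"
    have e: "enum_except i j (k # ks)" "enum_except i k (j # ks)" using that ks by (auto simp: enum_except_def)
    have "F i j = labelled i j a (k # ks) * gen1 i k * merges v"
      using F[OF _ e(1)] absorb[of i k] that by (simp add: mult.assoc)
    also have "\<dots> = gen i j (a i) (a j) * gen i k 1 (a k) * ?l j * merges v"
      by (subst labelled_fan) (use that(1) ks in auto)
    also have "gen i j (a i) (a j) * gen i k 1 (a k) = gen i k (a i) (a k) * gen i j 1 (a j)"
      using gen_fan1[of i j k "a i" "a j" 1 "a k"] that by simp
    \<comment> \<open>Both \<open>j\<close> and \<open>k\<close> are holes by now, so the remaining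
      labels can be written through \<open>k\<close>.\<close>
    also have "gen i k (a i) (a k) * gen i j 1 (a j) * ?l j
        = gen i k (a i) (a k) * gen i j 1 (a j) * ?l k"
      using that(1) ks
      by (intro two_holes_labels hole_gen hole_persists[OF hole_gen_one])
        (auto simp: image_image)
    also have "\<dots> * merges v = labelled i k a (j # ks) * gen1 i j * merges v"
      by (subst labelled_fan) (use that(1) ks in auto)
    also have "\<dots> = F i k"
      using F[OF _ e(2)] absorb[of i j] that by (simp add: mult.assoc)
    finally show ?thesis .
  qed
  have disj: "F i j = F k l" if "distinct [i, j, k, l]" "\<alpha> i = \<alpha> j" "\<alpha> k = \<alpha> l" for i j k l
  proof -
    obtain ks where ks: "distinct ks" "set ks = UNIV - {i, j, k, l}"
      using finite_distinct_list[of "UNIV - {i, j, k, l}"] by auto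
    let ?l = "\<lambda>j. labels j (map (\<lambda>m. (m, a m)) ks)"
    have e: "enum_except i j (k # l # ks)" "enum_except k l (i # j # ks)" using that ks by (auto simp: enum_except_def)
    have "F i j = labelled i j a (k # l # ks) * gen1 k l * merges v"
      using F[OF _ e(1)] absorb[of k l] that by (simp add: mult.assoc)
    also have "\<dots> = gen i j (a i) (a j) * gen k l (a k) (a l) * ?l j * merges v"
      by (subst labelled_disjoint) (use that(1) ks in auto)
    also have "gen i j (a i) (a j) * gen k l (a k) (a l) = gen k l (a k) (a l) * gen i j (a i) (a j)"
      using that by (intro gen_commute) auto
    also have "gen k l (a k) (a l) * gen i j (a i) (a j) * ?l j
        = gen k l (a k) (a l) * gen i j (a i) (a j) * ?l l"
      using that(1) ks
      by (intro two_holes_labels hole_gen hole_persists[OF hole_gen_one])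
        (auto simp: image_image)
    also have "\<dots> * merges v = labelled k l a (i # j # ks) * gen1 i j * merges v"
      by (subst labelled_disjoint) (use that(1) ks in auto)
    also have "\<dots> = F k l"
      using F[OF _ e(2)] absorb[of i j] that by (simp add: mult.assoc)
    finally show ?thesis .
  qed
  consider "i = k" "j = l" | "i = k" "j \<noteq> l" | "i = l" "j = k" | "i = l" "j \<noteq> k"
    | "j = k" "i \<noteq> l" | "j = l" "i \<noteq> k" | "distinct [i, j, k, l]"
    using assms by auto
  then have "F i j = F k l"
  proof cases
    case 2
    then show ?thesis using fan[of i j l] assms by auto
  next
    case 3
    then show ?thesis using flip[of i j] assms by auto
  next
    case 4
    have "F i j = F i k" by (rule fan) (use 4 assms(4-7) in auto)
    also have "\<dots> = F k i" by (rule flip) (use 4 assms(4-7) in auto)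
    finally show ?thesis using 4 by simp
  next
    case 5
    have "F i j = F j i" by (rule flip) (use 5 assms(4-7) in auto)
    also have "\<dots> = F j l" by (rule fan) (use 5 assms(4-7) in auto)
    finally show ?thesis using 5 by simp
  next
    case 6
    have "F i j = F j i" by (rule flip) (use 6 assms(4-7) in auto)
    also have "\<dots> = F j k" by (rule fan) (use 6 assms(4-7) in auto)
    also have "\<dots> = F k j" by (rule flip) (use 6 assms(4-7) in auto)
    finally show ?thesis using 6 by simp
  next
    case 7
    then show ?thesis using disj assms(6,7) by blast
  qed simp
  then show ?thesis using F[OF assms(4,8)] F[OF assms(5,9)] by simp
qed

section \<open>Evaluation of the normal form\<close>

definition coeff :: "('n, 'a::monoid_mult) wmon \<Rightarrow> 'n \<Rightarrow> 'a" where
  "coeff x = fst (val x)"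

lemma coeff_simps [simp]:
  "coeff 1 k = 1"
  "coeff (x * y) k = coeff x k * coeff y (to_map x k)"
  "coeff (gen i j a b) k = (if k = i then a else if k = j then b else 1)"
  by (cases "val x"; cases "val y"; simp add: coeff_def to_map_def val_mult eps_wr_def)+

lemma coeff_merges [simp]: "coeff (merges w) k = 1"
  by (induction w arbitrary: k) auto

lemma to_map_labels: "k \<noteq> h \<Longrightarrow> to_map (labels h L) k = k"
  by (induction L) (auto simp: eps_def)

lemma coeff_labels:
  assumes "k \<noteq> h" "distinct ks"
  shows "coeff (labels h (map (\<lambda>m. (m, a m)) ks)) k = (if k \<in> set ks then a k else 1)"
  using assms(2) assms(1) by (induction ks) (auto simp: eps_def)

lemma val_labelled_merges:
  fixes a :: "'n \<Rightarrow> 'a::monoid_mult"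
  assumes "i \<noteq> j" "enum_except i j ks" "to_map (merges v :: ('n, 'a::monoid_mult) wmon) i = to_map (merges v :: ('n, 'a) wmon) j"
  shows "val (labelled i j a ks * merges v) = (a, to_map (merges v :: ('n, 'a) wmon))"
proof -
  have "coeff (labelled i j a ks * merges v) k = a k" for k
    using assms(1,2) coeff_labels[of _ j ks a]
    by (auto simp: labelled_def eps_def enum_except_def)
  moreover have "to_map (labelled i j a ks * merges v) k = to_map (merges v :: ('n, 'a) wmon) k" for k
    using assms(1,3) to_map_labels[of _ j "map (\<lambda>k. (k, a k)) ks"] by (auto simp: labelled_def eps_def)
  ultimately show ?thesis
    unfolding coeff_def to_map_def by (auto simp: fun_eq_iff intro: prod_eqI)
qed

lemma to_wmon_normal_form:
  fixes w :: "('n::finite, 'a::monoid_mult) letter list"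
  assumes "w \<noteq> []" "set w \<subseteq> X2"
  shows "\<exists>i j a ks v. i \<noteq> j \<and> enum_except i j ks \<and> proper v \<and> v \<noteq> [] \<and>
    to_map (merges v :: ('n, 'a) wmon) i = to_map (merges v :: ('n, 'a) wmon) j \<and>
    to_wmon w = labelled i j a ks * merges v"
proof -
  obtain i j b c L v where 1: "i \<noteq> j" "j \<notin> fst ` set L" "proper v"
    "to_wmon w = gen i j b c * labels j L * merges v"
    using to_wmon_labels_first[OF assms] by blast
  obtain ks where ks: "enum_except i j ks" using enum_except_ex by blast
  obtain a where a: "gen i j b c * labels j L = labelled i j a ks"
    using labels_normal[OF 1(1,2) ks] by blast
  have "hole j (labelled i j a ks)"
    unfolding a[symmetric] using 1 by (intro hole_labels hole_gen_one)
  \<comment> \<open>The inserted letter is prepended to \<open>v\<close>, which makes the unlabelled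
    part non-empty and lets its map identify \<open>i\<close> and \<open>j\<close>.\<close>
  then have "labelled i j a ks = labelled i j a ks * gen1 i j" using holeD 1(1) by metis
  then have "to_wmon w = labelled i j a ks * merges ((i, j) # v)"
    using 1(4) a by (metis mult.assoc merges_simps(2))
  moreover have "proper ((i, j) # v)" using 1 by (auto simp: proper_def)
  ultimately show ?thesis using 1(1) ks
    by (intro exI[of _ i] exI[of _ j] exI[of _ a] exI[of _ ks] exI[of _ "(i, j) # v"])
      (auto simp: eps_def)
qed

lemma to_wmon_complete:
  fixes u v :: "('n::finite, 'a::monoid_mult) letter list"
  assumes "u \<noteq> []" "set u \<subseteq> X2" "v \<noteq> []" "set v \<subseteq> X2" "word_val u = word_val v"
  shows "to_wmon u = to_wmon v"
proof -
  obtain i j a ks w where u: "i \<noteq> j" "enum_except i j ks" "proper w" "w \<noteq> []"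
    "to_map (merges w :: ('n, 'a) wmon) i = to_map (merges w :: ('n, 'a) wmon) j"
    "to_wmon u = labelled i j a ks * merges w"
    using to_wmon_normal_form[OF assms(1,2)] by blast
  obtain k l b ls w' where v: "k \<noteq> l" "enum_except k l ls" "proper w'" "w' \<noteq> []"
    "to_map (merges w' :: ('n, 'a) wmon) k = to_map (merges w' :: ('n, 'a) wmon) l"
    "to_wmon v = labelled k l b ls * merges w'"
    using to_wmon_normal_form[OF assms(3,4)] by blast
  have "(a, to_map (merges w :: ('n, 'a) wmon)) = (b, to_map (merges w' :: ('n, 'a) wmon))"
    using val_labelled_merges[OF u(1,2,5)] val_labelled_merges[OF v(1,2,5)] u(6) v(6) assms(5) val_to_wmon by metis
  then have ab: "a = b" and t: "to_map (merges w :: ('n, 'a) wmon) = to_map (merges w' :: ('n, 'a) wmon)"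
    by auto
  have w: "merges w = (merges w' :: ('n, 'a) wmon)" using merges_complete[OF u(3,4) v(3,4) t] .
  show ?thesis
    unfolding u(6) v(6) w ab
    by (rule labelled_eq[OF v(3,4) u(1) v(1) u(5)[unfolded w] v(5) u(2) v(2)])
qed

lemma hole_swaps_eq_merges: "\<exists>w. proper w \<and> hole_swaps h ps = (merges w :: ('n, 'a::monoid_mult) wmon)"
proof (induction ps arbitrary: h)
  case Nil
  show ?case by (intro exI[of _ "[]"]) (simp add: proper_def)
next
  case (Cons x ps)
  obtain p q where x: "x = (p, q)" by fastforce
  obtain w where w: "proper w" "hole_swaps (transpose p q h) ps = (merges w :: ('n, 'a) wmon)"
    using Cons by blast
  have "\<exists>w. proper w \<and> hole_swap h p q = (merges w :: ('n, 'a) wmon)"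
  proof -
    consider "p = q" | "h = p" "p \<noteq> q" | "h = q" "p \<noteq> q" | "distinct [h, p, q]" by auto
    then show ?thesis
    proof cases
      case 1
      then show ?thesis by (intro exI[of _ "[]"]) (simp add: proper_def hole_swap_def)
    next
      case 2
      then show ?thesis by (intro exI[of _ "[(p, q)]"]) (simp add: proper_def hole_swap_def)
    next
      case 3
      then show ?thesis by (intro exI[of _ "[(q, p)]"]) (simp add: proper_def hole_swap_def)
    next
      case 4
      then show ?thesis
        by (intro exI[of _ "[(h, p), (p, q), (q, h)]"]) (auto simp: proper_def hole_swap_def mult.assoc)
    qed
  qed
  then obtain w' where "proper w'" "hole_swap h p q = (merges w' :: ('n, 'a) wmon)" by blast
  then show ?case using x w by (intro exI[of _ "w' @ w"]) (auto simp: proper_def)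
qed

section \<open>The presentation\<close>

text \<open>Induction on the number of points missed by \<alpha>. One of two identified points is
  sent to a missed point \<open>q\<close> instead, which gives a map \<beta> with \<alpha> equal to
  \<open>eps i j\<close> followed by \<beta>. Either \<beta> misses fewer points, or it is a
  permutation and is carried out with \<open>j\<close> as hole.\<close>

lemma singular_generated:
  fixes \<alpha> :: "'n::finite \<Rightarrow> 'n"
  assumes "\<not> inj \<alpha>"
  shows "\<exists>v. proper v \<and> v \<noteq> [] \<and> to_map (merges v :: ('n, 'a::monoid_mult) wmon) = \<alpha>"
  using assms
proof (induction "card (UNIV - range \<alpha>)" arbitrary: \<alpha> rule: less_induct)
  case less
  obtain i j where ij: "i \<noteq> j" "\<alpha> i = \<alpha> j" using less.prems by (auto simp: inj_def)
  obtain q where q: "q \<notin> range \<alpha>"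
    using less.prems finite_UNIV_surj_inj[of \<alpha>] by auto
  define \<beta> where "\<beta> = \<alpha>(j := q)"
  have \<beta>: "\<beta> (eps i j x) = \<alpha> x" for x using ij by (auto simp: eps_def \<beta>_def)
  have \<beta>j: "\<beta> j = q" by (simp add: \<beta>_def)
  show ?case
  proof (cases "inj \<beta>")
    case True
    then have "bij \<beta>"
      unfolding bij_def using finite_UNIV_inj_surj[OF finite True] by blast
    then have "\<beta> permutes UNIV" unfolding permutes_def bij_iff by blast
    then obtain ps where ps: "perm ps = \<beta>" using permutes_imp_perm[OF finite] by metis
    obtain w where w: "proper w" "hole_swaps j ps = (merges w :: ('n, 'a) wmon)"
      using hole_swaps_eq_merges[of j ps, where 'a = 'a] by (elim exE conjE)
    have "to_map (gen1 i j * hole_swaps j ps :: ('n, 'a) wmon) x = \<alpha> x" for x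
    proof -
      have "eps i j x \<noteq> j" using ij by (auto simp: eps_def)
      then have "to_map (hole_swaps j ps :: ('n, 'a) wmon) (eps i j x) = perm ps (eps i j x)"
        by (rule to_map_hole_swaps)
      then show ?thesis by (simp only: ps \<beta> to_map_simps comp_apply)
    qed
    then have "to_map (merges ((i, j) # w) :: ('n, 'a) wmon) = \<alpha>" using w by auto
    then show ?thesis using w ij by (intro exI[of _ "(i, j) # w"]) (auto simp: proper_def)
  next
    case False
    have "range \<alpha> \<subseteq> range \<beta>"
    proof
      fix y assume "y \<in> range \<alpha>"
      then obtain x where "y = \<alpha> x" by blast
      then show "y \<in> range \<beta>" using \<beta>[of x] by (metis rangeI)
    qed
    moreover have "q \<in> range \<beta>" using \<beta>j by (metis rangeI)
    ultimately have "UNIV - range \<beta> \<subset> UNIV - range \<alpha>" using q by blast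
    then have "card (UNIV - range \<beta>) < card (UNIV - range \<alpha>)"
      by (intro psubset_card_mono finite)
    then obtain v where v: "proper v" "to_map (merges v :: ('n, 'a) wmon) = \<beta>"
      using less.hyps False by blast
    have "to_map (merges ((i, j) # v) :: ('n, 'a) wmon) = \<alpha>"
      using v(2) \<beta> by (simp add: fun_eq_iff)
    then show ?thesis using v ij by (intro exI[of _ "(i, j) # v"]) (auto simp: proper_def)
  qed
qed

lemma phi2_eq_word_val: "w \<noteq> [] \<Longrightarrow> phi2 w = word_val w"
proof (induction w rule: list_nonempty_induct)
  case (single x)
  show ?case by (simp add: phi2_def)
next
  case (cons x w)
  then show ?case by (cases w) (simp_all add: phi2_def)
qed

lemma not_inj_word_val:
  fixes w :: "('n::finite, 'a::monoid_mult) letter list"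
  assumes "w \<noteq> []" "set w \<subseteq> X2"
  shows "\<not> inj (snd (word_val w))"
proof -
  obtain i j a b w' where w: "w = E i j a b # w'" "i \<noteq> j"
    using assms by (cases w) (auto simp: X2_def)
  have "snd (word_val w) i = snd (word_val w) j"
    using w by (cases "word_val w'") (simp add: eps_wr_def eps_def)
  then show ?thesis using w(2) by (auto dest: injD)
qed

lemma phi2_image: "phi2 ` free_semigroup X2
    = (wreath_Sing :: (('n::finite \<Rightarrow> 'a::monoid_mult) \<times> ('n \<Rightarrow> 'n)) set)"
proof (intro equalityI subsetI)
  fix x :: "('n \<Rightarrow> 'a) \<times> ('n \<Rightarrow> 'n)" assume "x \<in> phi2 ` free_semigroup X2"
  then obtain w where "w \<noteq> []" "set w \<subseteq> X2" "x = word_val w"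
    by (auto simp: free_semigroup_def phi2_eq_word_val)
  then show "x \<in> wreath_Sing"
    using not_inj_word_val[of w] by (simp add: wreath_Sing_def Sing_def bij_def mem_Times_iff)
next
  fix x :: "('n \<Rightarrow> 'a) \<times> ('n \<Rightarrow> 'n)" assume "x \<in> wreath_Sing"
  then obtain a \<alpha> where x: "x = (a, \<alpha>)" "\<not> bij \<alpha>" by (auto simp: wreath_Sing_def Sing_def)
  then have "\<not> inj \<alpha>" using finite_UNIV_inj_surj[of \<alpha>] by (auto simp: bij_def)
  then obtain v where v: "proper v" "to_map (merges v :: ('n, 'a) wmon) = \<alpha>"
    using singular_generated by blast
  obtain i j where ij: "i \<noteq> j" "\<alpha> i = \<alpha> j" using \<open>\<not> inj \<alpha>\<close> by (auto simp: inj_def)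
  obtain ks where ks: "enum_except i j ks" using enum_except_ex by blast
  let ?w = "E i j (a i) (a j) # map (\<lambda>k. E k j (a k) 1) ks @ map (\<lambda>(i, j). E1 i j) v"
  have "to_wmon (map (\<lambda>k. E k j (a k) 1) ks) = labels j (map (\<lambda>k. (k, a k)) ks)" for ks
    by (induction ks) auto
  moreover have "to_wmon (map (\<lambda>(i, j). E1 i j) v) = (merges v :: ('n, 'a) wmon)" for v
    by (induction v) auto
  ultimately have "to_wmon ?w = labelled i j a ks * merges v" by (simp add: labelled_def mult.assoc)
  then have "word_val ?w = x"
    using val_labelled_merges[OF ij(1) ks, of v a] v(2) ij(2) x(1) val_to_wmon[of ?w] by simp
  moreover have "?w \<in> free_semigroup X2"
    using ij(1) ks v(1) by (auto simp: free_semigroup_def X2_def proper_def enum_except_def)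
  moreover have "phi2 ?w = word_val ?w" by (rule phi2_eq_word_val) simp
  ultimately show "x \<in> phi2 ` free_semigroup X2" by (intro image_eqI[of _ _ ?w]) simp_all
qed

section \<open>Comparison with the generated congruence\<close>

lemma E_in_X2 [simp]: "E i j a b \<in> X2 \<longleftrightarrow> i \<noteq> j"
  by (auto simp: X2_def)

lemma R2_free: "(l, r) \<in> R2 \<Longrightarrow> l \<in> free_semigroup X2 \<and> r \<in> free_semigroup X2"
  by (cases rule: R2.cases) (auto simp: free_semigroup_def)

text \<open>Membership in the free semigroup is carried along because transitivity passes through an
  intermediate word, which must be known to lie there too.\<close>

lemma congruence_eqv:
  assumes "congruence_on X2 r" "R2 \<subseteq> r" "eqv u v"
  shows "(u \<in> free_semigroup X2 \<longleftrightarrow> v \<in> free_semigroup X2) \<and>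
    (u \<in> free_semigroup X2 \<longrightarrow> (u, v) \<in> r)"
proof -
  have eq: "refl_on (free_semigroup X2) r" "sym r" "trans r"
    using assms(1) by (simp_all add: congruence_on_def equiv_def)
  show ?thesis
    using assms(3)
  proof (induction rule: eqv.induct)
    case (refl u)
    show ?case using refl_onD[OF eq(1)] by blast
  next
    case (sym u v)
    then show ?case using symD[OF eq(2)] by blast
  next
    case (trans u v w)
    then show ?case using transD[OF eq(3)] by blast
  next
    case (step l r' p s)
    have lr: "l \<in> free_semigroup X2" "r' \<in> free_semigroup X2" "(l, r') \<in> r"
      using R2_free[OF step] step assms(2) by auto
    then have iff: "p @ l @ s \<in> free_semigroup X2 \<longleftrightarrow> p @ r' @ s \<in> free_semigroup X2"
      by (auto simp: free_semigroup_def)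
    have ctx: "(w @ x, w @ y) \<in> r \<and> (x @ w, y @ w) \<in> r"
      if "(x, y) \<in> r" "w \<in> free_semigroup X2" for x y w
      using bspec[OF conjunct2[OF assms(1)[unfolded congruence_on_def]] that(1)] that(2) by simp
    have "(p @ l @ s, p @ r' @ s) \<in> r" if "p @ l @ s \<in> free_semigroup X2"
    proof -
      \<comment> \<open>The contexts may be empty, whereas \<open>congruence_on\<close> only allows
        multiplication by non-empty words.\<close>
      have "p = [] \<or> p \<in> free_semigroup X2" "s = [] \<or> s \<in> free_semigroup X2"
        using that by (auto simp: free_semigroup_def)
      moreover from this(2) have "(l @ s, r' @ s) \<in> r" using lr(3) ctx by auto
      ultimately show ?thesis using ctx by auto
    qed
    then show ?case using iff by simp
  qed
qed

lemma congruence_kernel: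
  "congruence_on X2 {(u, v). u \<in> free_semigroup X2 \<and> v \<in> free_semigroup X2 \<and> word_val u = word_val v}"
  unfolding congruence_on_def
  by (auto simp: equiv_def refl_on_def sym_def trans_def free_semigroup_def word_val_append)

theorem theorem5p2:
  assumes "CARD('n::finite) \<ge> 2"
  shows "semigroup_presentation
    (wreath_Sing :: (('n \<Rightarrow> 'a::monoid_mult) \<times> ('n \<Rightarrow> 'n)) set) wreath_mult X2 R2 phi2"
  unfolding semigroup_presentation_def
proof (intro conjI)
  let ?F = "free_semigroup X2 :: ('n, 'a) letter list set"
  have hom: "\<forall>u \<in> ?F. \<forall>v \<in> ?F. phi2 (u @ v) = wreath_mult (phi2 u) (phi2 v)"
    by (auto simp: free_semigroup_def phi2_eq_word_val word_val_append)
  then show "\<forall>u \<in> ?F. \<forall>v \<in> ?F. phi2 (u @ v) = wreath_mult (phi2 u) (phi2 v)" .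
  show im: "phi2 ` ?F = wreath_Sing" by (rule phi2_image)
  show "semigroup_on (wreath_Sing :: (('n \<Rightarrow> 'a) \<times> ('n \<Rightarrow> 'n)) set) wreath_mult"
    unfolding semigroup_on_def
  proof (intro conjI ballI)
    fix x y :: "('n \<Rightarrow> 'a) \<times> ('n \<Rightarrow> 'n)" assume "x \<in> wreath_Sing" "y \<in> wreath_Sing"
    \<comment> \<open>Closure is inherited from words, through surjectivity of \<open>phi2\<close>
      and the homomorphism property.\<close>
    then obtain u v where uv: "u \<in> ?F" "v \<in> ?F" "x = phi2 u" "y = phi2 v" using im by blast
    then have "u @ v \<in> ?F" by (auto simp: free_semigroup_def)
    then show "wreath_mult x y \<in> wreath_Sing" using uv hom im by (metis image_eqI)
  qed (simp add: wreath_mult_assoc)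
  show "(R2 :: (('n, 'a) letter list \<times> ('n, 'a) letter list) set) \<subseteq> ?F \<times> ?F"
    by (rule subrelI) (simp add: R2_free)
  show "{(u, v) \<in> ?F \<times> ?F. phi2 u = phi2 v} = generated_congruence X2 R2"
  proof (intro equalityI subsetI)
    fix x assume "x \<in> {(u, v) \<in> ?F \<times> ?F. phi2 u = phi2 v}"
    then obtain u v where x: "x = (u, v)" "u \<in> ?F" "v \<in> ?F" "phi2 u = phi2 v" by blast
    then have "word_val u = word_val v" by (auto simp: free_semigroup_def phi2_eq_word_val)
    then have "eqv u v"
      using x to_wmon_complete[of u v] by (auto simp: free_semigroup_def to_wmon_eq_iff)
    then show "x \<in> generated_congruence X2 R2"
      using x congruence_eqv by (auto simp: generated_congruence_def)
  next
    fix x :: "('n, 'a) letter list \<times> ('n, 'a) letter list"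
    let ?K = "{(u, v). u \<in> ?F \<and> v \<in> ?F \<and> word_val u = word_val v}"
    assume "x \<in> generated_congruence X2 R2"
    \<comment> \<open>The kernel of evaluation is itself a congruence containing \<open>R2\<close>,
      hence contains the generated one.\<close>
    moreover have "R2 \<subseteq> ?K" by (rule subrelI) (simp add: R2_free R2_sound)
    ultimately have "x \<in> ?K"
      using congruence_kernel unfolding generated_congruence_def by blast
    then show "x \<in> {(u, v) \<in> ?F \<times> ?F. phi2 u = phi2 v}"
      by (auto simp: free_semigroup_def phi2_eq_word_val)
  qed
qed

end
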